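(* There exists a family of virtual knots $\{K_{m,n}\}_{m,n\ge 1}$, indexed by positive integers $m,n$, such that $b_1(K_{m,n}) = m$ for all $m,n\geq 1$ and, for every $m\ge 1$, $$\lim_{n\rightarrow\infty} \bigl(b_2(K_{m,n})-b_1(K_{m,n})\bigr)=\infty .$$ Here $b_1$ and $b_2$ denote the first and second bridge numbers of a virtual knot.
   Context: **Virtual knots.** A virtual knot diagram is a generic immersion of an oriented circle in the plane whose double points are either classical crossings (with over/under information) or virtual crossings (no over/under information). A virtual knot is an equivalence class of such diagrams under the generalized Reidemeister moves (the three classical Reidemeister moves, the three purely virtual analogues, and the mixed move passing an arc with only virtual crossings across a classical crossing). Equivalently, a virtual knot is an equivalence class of Gauss codes decorated with crossing signs, up to cyclic permutation and the Reidemeister moves on codes (all possible codes being allowed, not only those realizable by planar classical diagrams). **Gauss codes.** A Gauss code is a finite sequence $\{a_i\}_{i=1}^{2k}$ in which each element of $\{\pm 1,\dots,\pm k\}$ appears exactly once. A virtual knot diagram with classical crossings labelled $1,\dots,k$ yields a Gauss code by travelling once around the diagram from a starting point and recording $i$ when passing over crossing $i$ and $-i$ when passing under crossing $i$; virtual crossings are not recorded. Codes are read cyclically. A Gauss code represents a virtual knot $K$ if it arises from a diagram of $K$. **First bridge number.** In a Gauss code (read cyclically), a strand is a consecutive string of entries starting at a negative entry and ending at the next negative entry (diagrammatically: an arc going from one undercrossing to the next undercrossing). A strand containing at least one positive integer is called an overbridge. The first bridge number $b_1(K)$ of a virtual knot $K$ is the minimum number of overbridges over all Gauss codes representing $K$;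 by convention, $b_1$ of the unknot is $1$. **Second bridge number.** Perturb a virtual knot diagram in $\mathbb{R}^2$ so that the standard height function $h:\mathbb{R}^2\to\mathbb{R}$ restricts to the underlying immersed curve as a function with finitely many nondegenerate local maxima and local minima (equal in number), none of them at crossings. The second bridge number $b_2(K)$ is the minimum number of local maxima over all such virtual knot diagrams of $K$. *)

theory Defs
  imports "HOL-Analysis.Analysis"
begin

section \<open>Signed Gauss codes\<close>

text \<open>
  An entry \<open>(a, e)\<close> records passing over (\<open>a > 0\<close>) or under (\<open>a < 0\<close>) the classical crossing
  labelled \<open>\<bar>a\<bar>\<close>, whose sign is \<open>e\<close>; the first components alone form the (undecorated) Gauss code.
\<close>

type_synonym code = "(int \<times> int) list"

definition gauss_code :: "code \<Rightarrow> bool" where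
  "gauss_code c \<longleftrightarrow>
     distinct (map fst c) \<and>
     (\<exists>k::nat. fst ` set c = {a. 1 \<le> \<bar>a\<bar> \<and> \<bar>a\<bar> \<le> int k}) \<and>
     snd ` set c \<subseteq> {1, -1} \<and>
     (\<forall>(a, e) \<in> set c. \<forall>(b, f) \<in> set c. \<bar>a\<bar> = \<bar>b\<bar> \<longrightarrow> e = f)"

section \<open>Reidemeister moves on codes\<close>

text \<open>
  \<open>r3_segments S1 S2 S3\<close>: the top, middle and bottom strands of a triangle run through the entries
  \<open>S1\<close>, \<open>S2\<close>, \<open>S3\<close>.  Crossing \<open>a\<close> is top over middle, \<open>b\<close> is top over bottom, \<open>c\<close> is middle over
  bottom.  The number \<open>o1\<close> (\<open>o2\<close>, \<open>o3\<close>) is \<open>1\<close> if the top (middle, bottom) strand is directed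
  from \<open>a\<close> to \<open>b\<close> (\<open>a\<close> to \<open>c\<close>, \<open>b\<close> to \<open>c\<close>) and \<open>-1\<close> otherwise, and \<open>d\<close> is the orientation of the
  plane triangle \<open>(a, b, c)\<close>.  The sign of a crossing is that of the cross product of the directions
  of its over- and understrand, which up to positive factors are \<open>o1 (b - a)\<close>, \<open>o2 (c - a)\<close>,
  \<open>o3 (c - b)\<close>; hence the signs below.  The move reverses all three segments, that is, it negates
  \<open>o1\<close>, \<open>o2\<close>, \<open>o3\<close> and keeps \<open>d\<close> and the crossing signs.
\<close>

definition directed :: "int \<Rightarrow> 'a \<Rightarrow> 'a \<Rightarrow> 'a list" where
  "directed s x y = (if s = 1 then [x, y] else [y, x])"

inductive r3_segments :: "code \<Rightarrow> code \<Rightarrow> code \<Rightarrow> bool" where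
  "0 < a \<Longrightarrow> 0 < b \<Longrightarrow> 0 < c \<Longrightarrow> {o1, o2, o3, d} \<subseteq> {1, -1} \<Longrightarrow>
   r3_segments
     (directed o1 (a, o1 * o2 * d) (b, o1 * o3 * d))
     (directed o2 (-a, o1 * o2 * d) (c, o2 * o3 * d))
     (directed o3 (-b, o1 * o3 * d) (-c, o2 * o3 * d))"

text \<open>
  Codes are read cyclically, so up to \<open>rotate\<close> the overstrand of a second move and the top
  strand of a third move may be assumed to come first.  In \<open>r1\<close> the label \<open>a\<close> may be negative, which
  covers both orders of passing.  The two rules for the second move are those for equally and
  for oppositely directed strands.  The virtual and mixed moves do not change the code.
\<close>

inductive raw_move :: "code \<Rightarrow> code \<Rightarrow> bool" where
  rotate: "raw_move c (rotate1 c)"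
| relabel: "inj f \<Longrightarrow>
    raw_move c (map (\<lambda>(a, e). (sgn a * int (f (nat \<bar>a\<bar>)), e)) c)"
| r1: "raw_move (A @ B) (A @ [(a, e), (-a, e)] @ B)"
| r2_parallel: "0 < a \<Longrightarrow> 0 < b \<Longrightarrow>
    raw_move (A @ B) ([(a, e), (b, -e)] @ A @ [(-a, e), (-b, -e)] @ B)"
| r2_antiparallel: "0 < a \<Longrightarrow> 0 < b \<Longrightarrow>
    raw_move (A @ B) ([(a, e), (b, -e)] @ A @ [(-b, -e), (-a, e)] @ B)"
| r3_top_middle_bottom: "r3_segments S1 S2 S3 \<Longrightarrow>
    raw_move (S1 @ A @ S2 @ B @ S3 @ C) (rev S1 @ A @ rev S2 @ B @ rev S3 @ C)"
| r3_top_bottom_middle: "r3_segments S1 S2 S3 \<Longrightarrow>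
    raw_move (S1 @ A @ S3 @ B @ S2 @ C) (rev S1 @ A @ rev S3 @ B @ rev S2 @ C)"

text \<open>
  Demanding Gauss codes on both sides forces a relabelling to permute the labels in use and
  created crossings to carry the next free labels.
\<close>

definition code_move :: "code \<Rightarrow> code \<Rightarrow> bool" where
  "code_move c c' \<longleftrightarrow> gauss_code c \<and> gauss_code c' \<and> raw_move c c'"

definition code_equiv :: "(code \<times> code) set" where
  "code_equiv = {(c, c'). gauss_code c \<and> gauss_code c' \<and> equivclp code_move c c'}"

lemma equiv_code_equiv: "equiv {c. gauss_code c} code_equiv"
proof (rule equivI)
  show "refl_on {c. gauss_code c} code_equiv"
    by (auto simp: refl_on_def code_equiv_def)
  show "sym code_equiv"
    by (auto simp: sym_def code_equiv_def intro: equivclp_sym)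
  show "trans code_equiv"
    by (auto simp: trans_def code_equiv_def intro: equivclp_trans)
qed (auto simp: code_equiv_def)

definition virtual_knots :: "code set set" where
  "virtual_knots = {c. gauss_code c} // code_equiv"

definition unknot :: "code set" where
  "unknot = code_equiv `` {[]}"

section \<open>First bridge number\<close>

text \<open>The strand starting at position \<open>i\<close>, read cyclically up to and including the next negative entry.\<close>

definition strand :: "code \<Rightarrow> nat \<Rightarrow> code" where
  "strand c i =
     (let r = rotate i c; later = tl r @ [hd r]; pos = (\<lambda>(a, e). 0 < a)
      in hd r # takeWhile pos later @ [hd (dropWhile pos later)])"

definition overbridges :: "code \<Rightarrow> nat" where
  "overbridges c =
     card {i. i < length c \<and> fst (c ! i) < 0 \<and> (\<exists>(a, e) \<in> set (strand c i). 0 < a)}"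

definition b1 :: "code set \<Rightarrow> nat" where
  "b1 K = (if K = unknot then 1 else Inf (overbridges ` K))"

section \<open>Virtual knot diagrams\<close>

text \<open>
  The plane is \<open>complex\<close>, and a closed curve is a map on the reals of period \<open>1\<close>, traversed in the
  direction of increasing parameter.
\<close>

definition smooth :: "(real \<Rightarrow> complex) \<Rightarrow> bool" where
  "smooth \<gamma> \<longleftrightarrow> (\<forall>n t. ((\<lambda>f t. vector_derivative f (at t)) ^^ n) \<gamma> differentiable (at t))"

definition cross :: "complex \<Rightarrow> complex \<Rightarrow> real" where
  "cross v w = Re v * Im w - Im v * Re w"

definition tangent :: "(real \<Rightarrow> complex) \<Rightarrow> real \<Rightarrow> complex" where
  "tangent \<gamma> t = vector_derivative \<gamma> (at t)"

definition double_points :: "(real \<Rightarrow> complex) \<Rightarrow> (real \<times> real) set" where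
  "double_points \<gamma> = {(s, t). s \<in> {0..<1} \<and> t \<in> {0..<1} \<and> s \<noteq> t \<and> \<gamma> s = \<gamma> t}"

definition generic_immersion :: "(real \<Rightarrow> complex) \<Rightarrow> bool" where
  "generic_immersion \<gamma> \<longleftrightarrow>
     (\<forall>t. \<gamma> (t + 1) = \<gamma> t) \<and> smooth \<gamma> \<and> (\<forall>t. tangent \<gamma> t \<noteq> 0) \<and>
     finite (double_points \<gamma>) \<and>
     (\<forall>(s, t) \<in> double_points \<gamma>. cross (tangent \<gamma> s) (tangent \<gamma> t) \<noteq> 0) \<and>
     (\<forall>s t u. (s, t) \<in> double_points \<gamma> \<and> (s, u) \<in> double_points \<gamma> \<longrightarrow> t = u)"

text \<open>
  The set \<open>X\<close> consists of the classical crossings, each given as the pair of the parameter of the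
  overpass and that of the underpass.  The remaining double points are the virtual crossings.
\<close>

definition virtual_diagram :: "(real \<Rightarrow> complex) \<Rightarrow> (real \<times> real) set \<Rightarrow> bool" where
  "virtual_diagram \<gamma> X \<longleftrightarrow>
     generic_immersion \<gamma> \<and> X \<subseteq> double_points \<gamma> \<and> (\<forall>(s, t) \<in> X. (t, s) \<notin> X)"

definition crossing_sign :: "(real \<Rightarrow> complex) \<Rightarrow> real \<times> real \<Rightarrow> int" where
  "crossing_sign \<gamma> x = (if 0 < cross (tangent \<gamma> (fst x)) (tangent \<gamma> (snd x)) then 1 else -1)"

text \<open>The code \<open>c\<close> is read off the diagram from parameter \<open>0\<close> on, for some labelling \<open>l\<close> of the crossings.\<close>

definition diagram_code :: "(real \<Rightarrow> complex) \<Rightarrow> (real \<times> real) set \<Rightarrow> code \<Rightarrow> bool" where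
  "diagram_code \<gamma> X c \<longleftrightarrow>
     (\<exists>l :: real \<times> real \<Rightarrow> nat.
        let ts = sorted_list_of_set (fst ` X \<union> snd ` X) in
          bij_betw l X {1..card X} \<and> length c = length ts \<and>
          (\<forall>i < length c. \<exists>x \<in> X.
             (ts ! i = fst x \<and> c ! i = (int (l x), crossing_sign \<gamma> x)) \<or>
             (ts ! i = snd x \<and> c ! i = (- int (l x), crossing_sign \<gamma> x))))"

definition diagram_of :: "(real \<Rightarrow> complex) \<Rightarrow> (real \<times> real) set \<Rightarrow> code set \<Rightarrow> bool" where
  "diagram_of \<gamma> X K \<longleftrightarrow> virtual_diagram \<gamma> X \<and> (\<exists>c \<in> K. diagram_code \<gamma> X c)"

section \<open>Second bridge number\<close>

definition height :: "(real \<Rightarrow> complex) \<Rightarrow> real \<Rightarrow> real" where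
  "height \<gamma> t = Im (\<gamma> t)"

definition local_maxima :: "(real \<Rightarrow> complex) \<Rightarrow> real set" where
  "local_maxima \<gamma> = {t \<in> {0..<1}. \<forall>\<^sub>F s in at t. height \<gamma> s \<le> height \<gamma> t}"

definition local_minima :: "(real \<Rightarrow> complex) \<Rightarrow> real set" where
  "local_minima \<gamma> = {t \<in> {0..<1}. \<forall>\<^sub>F s in at t. height \<gamma> t \<le> height \<gamma> s}"

definition height_generic :: "(real \<Rightarrow> complex) \<Rightarrow> bool" where
  "height_generic \<gamma> \<longleftrightarrow>
     finite (local_maxima \<gamma> \<union> local_minima \<gamma>) \<and>
     (\<forall>t \<in> local_maxima \<gamma> \<union> local_minima \<gamma>.
        deriv (deriv (height \<gamma>)) t \<noteq> 0 \<and> t \<notin> fst ` double_points \<gamma>)"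

text \<open>
  The infimum is taken in the extended naturals.  Every signed Gauss code is realised by a
  diagram, so it is an attained minimum.
\<close>

definition b2 :: "code set \<Rightarrow> enat" where
  "b2 K = Inf {enat (card (local_maxima \<gamma>)) | \<gamma> X. diagram_of \<gamma> X K \<and> height_generic \<gamma>}"

end

theory Submission
  imports Defs
begin

text \<open>
  Both bridge numbers are bounded below by counting Fox 3-colourings.  A 3-colouring of a nonempty
  code is determined by the colours of its overbridges, so \<open>c\<close> has at most \<open>3 ^ overbridges c\<close> of them, and
  their number is invariant under the moves.  It is also at most \<open>3\<close> to the number of maxima of any
  diagram: if two colourings agree on all arcs that contain a maximum, then every arc on which they
  differ lies below its higher end.  At a highest such end two strands cross, each of them has an arc
  on which the colourings agree, and the rule at the crossing propagates agreement to all four arcs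
  (\<open>num_colorings_le_maxima\<close>).  This argument uses only that the two passages of a crossing have
  equal height, and not which of them is the overpass.

  The last remark separates the two numbers.  Let \<open>P\<close> be a function on the arcs of a code that
  changes by the sign of the crossing at an overpass and by its negative at an underpass.  The
  difference of \<open>P\<close> between the two passages of a crossing is the index of the crossing.  It is
  preserved by the moves, and in a third move the index of the top-bottom crossing is the sum of the
  other two.  Switch every crossing of negative index.  Among the three strands of a third move the
  new over-under relation is again a linear order, so equivalent codes have switched codes with
  equally many 3-colourings (\<open>index_colorings_equiv\<close>).  Switching may create overbridges, but it does
  not affect the heights of a diagram, so the colourings of the switched code still bound \<open>b2\<close> from
  below.

  It remains to find codes with \<open>m\<close> overbridges that have \<open>3 ^ m\<close> colourings before and at least
  \<open>3 ^ n\<close> colourings after switching.  A cyclic chain of \<open>m\<close> overbridges in which each underpass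
  block runs under the next bridge and then under the previous one admits every choice of bridge
  colours.  Between two such blocks, \<open>n\<close> nested copies of a four-crossing gadget are inserted, all
  overpasses first and all underpasses last, which adds no bridge; after switching, each gadget
  can be coloured with a free parameter while its outer arcs keep the colour \<open>0\<close>.
\<close>

section \<open>Fox 3-colourings of unsigned Gauss codes\<close>

text \<open>The colours form the field with three elements.\<close>

type_synonym color = 3

text \<open>
  A list of nonzero integers is an unsigned code, a positive entry being an overpass.  The function
  \<open>z\<close> gives the colour of the overstrand at each crossing (a positive label).  \<open>colored z x w y\<close>
  means that a strand that enters \<open>w\<close> with colour \<open>x\<close> leaves it with colour \<open>y\<close>: its colour agrees with
  \<open>z\<close> at overpasses and is reflected in \<open>z\<close> at underpasses.
\<close>

fun colored :: "(int \<Rightarrow> color) \<Rightarrow> color \<Rightarrow> int list \<Rightarrow> color \<Rightarrow> bool" where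
  "colored z x [] y \<longleftrightarrow> x = y"
| "colored z x (a # w) y \<longleftrightarrow>
     (if 0 < a then z \<bar>a\<bar> = x \<and> colored z x w y else colored z (2 * z \<bar>a\<bar> - x) w y)"

text \<open>
  A colouring consists of the colour of the arc before the first entry and the colours of the
  overstrands, the latter being \<open>0\<close> outside the labels in use.
\<close>

definition colorings :: "int list \<Rightarrow> (color \<times> (int \<Rightarrow> color)) set" where
  "colorings w = {(x, z). colored z x w x \<and> (\<forall>k. k \<notin> abs ` set w \<longrightarrow> z k = 0)}"

definition num_colorings :: "int list \<Rightarrow> nat" where
  "num_colorings w = card (colorings w)"

lemma colored_append: "colored z x (v @ w) y \<longleftrightarrow> (\<exists>u. colored z x v u \<and> colored z u w y)"
  by (induction v arbitrary: x) auto

lemma colored_unique: "colored z x w y \<Longrightarrow> colored z x w y' \<Longrightarrow> y = y'"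
  by (induction w arbitrary: x) (auto split: if_splits)

lemma colored_cong:
  "(\<And>k. k \<in> abs ` set w \<Longrightarrow> z k = z' k) \<Longrightarrow> colored z x w y \<longleftrightarrow> colored z' x w y"
  by (induction w arbitrary: x) auto

lemma colored_off:
  assumes "L \<inter> abs ` set w = {}" "\<And>k. k \<notin> L \<Longrightarrow> z k = z' k"
  shows "colored z x w y \<longleftrightarrow> colored z' x w y"
  using assms by (intro colored_cong) blast

lemma finite_colorings: "finite (colorings w)"
proof -
  have "finite ((UNIV :: color set) \<times> {z :: int \<Rightarrow> color. z ` abs ` set w \<subseteq> UNIV \<and> {k. z k \<noteq> 0} \<subseteq> abs ` set w})"
  proof (rule finite_cartesian_product)
    have "finite {z :: int \<Rightarrow> color. \<forall>k. (k \<in> abs ` set w \<longrightarrow> z k \<in> UNIV) \<and> (k \<notin> abs ` set w \<longrightarrow> z k = 0)}"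
      by (rule finite_set_of_finite_funs) auto
    then show "finite {z :: int \<Rightarrow> color. z ` abs ` set w \<subseteq> UNIV \<and> {k. z k \<noteq> 0} \<subseteq> abs ` set w}"
      by (rule rev_finite_subset) auto
  qed (rule finite)
  then show ?thesis
    by (rule rev_finite_subset) (auto simp: colorings_def)
qed

text \<open>
  The common part of the first two moves: the crossings \<open>L\<close> are added, and the colours of their
  overstrands exist and are determined by the colouring of the old code.
\<close>

lemma num_colorings_extend:
  assumes disj: "L \<inter> abs ` set w = {}" and un: "abs ` set w' = abs ` set w \<union> L"
    and drop: "\<And>x z. colored z x w' x \<Longrightarrow> colored z x w x"
    and extend: "\<And>x z. colored z x w x \<Longrightarrow> \<exists>v. colored (\<lambda>k. if k \<in> L then v k else z k) x w' x"
    and det: "\<And>x z z' k. colored z x w' x \<Longrightarrow> colored z' x w' x \<Longrightarrow> (\<And>k. k \<notin> L \<Longrightarrow> z k = z' k)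
      \<Longrightarrow> k \<in> L \<Longrightarrow> z k = z' k"
  shows "num_colorings w' = num_colorings w"
proof -
  let ?r = "\<lambda>(x :: color, z :: int \<Rightarrow> color). (x, \<lambda>k. if k \<in> L then 0 else z k)"
  have "bij_betw ?r (colorings w') (colorings w)"
    unfolding bij_betw_def
  proof
    show "inj_on ?r (colorings w')"
    proof (rule inj_onI)
      fix s t assume st: "s \<in> colorings w'" "t \<in> colorings w'" "?r s = ?r t"
      obtain x z x' z' where e: "s = (x, z)" "t = (x', z')" by (cases s, cases t)
      from st e have x: "x' = x" and zz: "\<And>k. k \<notin> L \<Longrightarrow> z k = z' k"
        by (auto simp: fun_eq_iff split: if_splits)
      have "z k = z' k" for k
        using det[of z x z' k] zz st e x by (cases "k \<in> L") (auto simp: colorings_def)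
      with e x show "s = t" by auto
    qed
    show "?r ` colorings w' = colorings w"
    proof
      show "?r ` colorings w' \<subseteq> colorings w"
      proof clarify
        fix x z assume c: "(x, z) \<in> colorings w'"
        then have "colored z x w x" using drop by (auto simp: colorings_def)
        also have "colored z x w x \<longleftrightarrow> colored (\<lambda>k. if k \<in> L then 0 else z k) x w x"
          using disj by (intro colored_cong) auto
        finally show "(x, \<lambda>k. if k \<in> L then 0 else z k) \<in> colorings w"
          using c un by (auto simp: colorings_def)
      qed
      show "colorings w \<subseteq> ?r ` colorings w'"
      proof clarify
        fix x z assume c: "(x, z) \<in> colorings w"
        then obtain v where v: "colored (\<lambda>k. if k \<in> L then v k else z k) x w' x"
          using extend[of z x] unfolding colorings_def by blast
        have mem: "(x, \<lambda>k. if k \<in> L then v k else z k) \<in> colorings w'"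
          using v c un by (auto simp: colorings_def)
        have *: "(if k \<in> L then 0 else if k \<in> L then v k else z k) = z k" for k
          using c disj unfolding colorings_def by (cases "k \<in> L") (simp_all, blast)
        have "(\<lambda>k. if k \<in> L then 0 else if k \<in> L then v k else z k) = z"
          by (rule ext) (rule *)
        then have "?r (x, \<lambda>k. if k \<in> L then v k else z k) = (x, z)"
          by (simp only: prod.case)
        then show "(x, z) \<in> ?r ` colorings w'" by (rule image_eqI[OF sym mem])
      qed
    qed
  qed
  then show ?thesis by (simp add: num_colorings_def bij_betw_same_card)
qed

lemma cancel_twice: "2 * (z::color) - x = z \<longleftrightarrow> x = z"
proof -
  have "2 * z - x = z \<longleftrightarrow> z - x = 0" by (simp add: algebra_simps)
  then show ?thesis by auto
qed

lemma colored_pair_kink: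
  assumes "a \<noteq> 0"
  shows "colored z x [a, -a] y \<longleftrightarrow> z \<bar>a\<bar> = x \<and> y = x"
proof (cases "0 < a")
  case True
  then show ?thesis by auto
next
  case False
  with assms have "colored z x [a, -a] y \<longleftrightarrow> z \<bar>a\<bar> = 2 * z \<bar>a\<bar> - x \<and> 2 * z \<bar>a\<bar> - x = y" by simp
  then show ?thesis using cancel_twice[of "z \<bar>a\<bar>" x] by metis
qed

lemma num_colorings_r1:
  assumes a: "a \<noteq> 0" and new: "\<bar>a\<bar> \<notin> abs ` set (A @ B)"
  shows "num_colorings (A @ [a, -a] @ B) = num_colorings (A @ B)"
proof (rule num_colorings_extend[where L = "{\<bar>a\<bar>}"])
  show "{\<bar>a\<bar>} \<inter> abs ` set (A @ B) = {}" using new by auto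
  show "abs ` set (A @ [a, -a] @ B) = abs ` set (A @ B) \<union> {\<bar>a\<bar>}" by auto
  fix x z assume "colored z x (A @ [a, -a] @ B) x"
  then show "colored z x (A @ B) x"
    unfolding colored_append colored_pair_kink[OF a] by blast
next
  fix x z assume "colored z x (A @ B) x"
  then obtain u where u: "colored z x A u" "colored z u B x" unfolding colored_append by auto
  let ?z = "\<lambda>k. if k \<in> {\<bar>a\<bar>} then u else z k"
  have "colored ?z x A u"
    using u(1) colored_off[of "{\<bar>a\<bar>}" A ?z z] new by auto
  moreover have "colored ?z u B x"
    using u(2) colored_off[of "{\<bar>a\<bar>}" B ?z z] new by auto
  ultimately have "colored ?z x (A @ [a, -a] @ B) x"
    unfolding colored_append colored_pair_kink[OF a] by auto
  then show "\<exists>v. colored (\<lambda>k. if k \<in> {\<bar>a\<bar>} then v k else z k) x (A @ [a, -a] @ B) x"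
    by (intro exI[of _ "\<lambda>_. u"]) simp
next
  fix x z z' k
  assume p: "colored z x (A @ [a, -a] @ B) x" "colored z' x (A @ [a, -a] @ B) x"
    and e: "\<And>k. k \<notin> {\<bar>a\<bar>} \<Longrightarrow> z k = z' k" and k: "k \<in> {\<bar>a\<bar>}"
  have *: "colored z x A u \<longleftrightarrow> colored z' x A u" for u
    using e new by (intro colored_off[of "{\<bar>a\<bar>}"]) auto
  from p(1) obtain u where u: "colored z x A u" "z \<bar>a\<bar> = u"
    unfolding colored_append colored_pair_kink[OF a] by blast
  from p(2) obtain u' where u': "colored z' x A u'" "z' \<bar>a\<bar> = u'"
    unfolding colored_append colored_pair_kink[OF a] by blast
  from u u' show "z k = z' k" using * colored_unique k by auto
qed

lemma num_colorings_r2_aux: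
  assumes L: "L = {a, b}" and pos: "0 < a" "0 < b" and new: "L \<inter> abs ` set (A @ B) = {}"
    and S: "(set S = {a, b} \<and> set T = {-a, -b}) \<or> (set T = {a, b} \<and> set S = {-a, -b})"
    and d: "\<And>z x y u v. colored z x S y \<and> colored z u T v \<longleftrightarrow> y = x \<and> v = u \<and> z a = g x u \<and> z b = g x u"
  shows "num_colorings (S @ A @ T @ B) = num_colorings (A @ B)"
proof (rule num_colorings_extend[where L = L])
  show "L \<inter> abs ` set (A @ B) = {}" by (fact new)
  show "abs ` set (S @ A @ T @ B) = abs ` set (A @ B) \<union> L"
    using S pos L by (auto simp: image_Un)
  have split: "colored z x (S @ A @ T @ B) y \<longleftrightarrow>
      (\<exists>u. colored z x A u \<and> colored z u B y \<and> z a = g x u \<and> z b = g x u)" for z x y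
  proof
    assume "colored z x (S @ A @ T @ B) y"
    then obtain p u v where "colored z x S p" "colored z p A u" "colored z u T v" "colored z v B y"
      unfolding colored_append by blast
    moreover from this have "p = x" "v = u" "z a = g x u" "z b = g x u"
      using d[of z x p u v] by blast+
    ultimately show "\<exists>u. colored z x A u \<and> colored z u B y \<and> z a = g x u \<and> z b = g x u" by blast
  next
    assume "\<exists>u. colored z x A u \<and> colored z u B y \<and> z a = g x u \<and> z b = g x u"
    then obtain u where u: "colored z x A u" "colored z u B y" "z a = g x u" "z b = g x u" by blast
    then have "colored z x S x \<and> colored z u T u" using d[of z x x u u] by blast
    with u show "colored z x (S @ A @ T @ B) y" unfolding colored_append by blast
  qed
  fix x z
  {
    assume "colored z x (S @ A @ T @ B) x"
    then show "colored z x (A @ B) x" using split colored_append by blast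
  next
    assume "colored z x (A @ B) x"
    then obtain u where u: "colored z x A u" "colored z u B x" unfolding colored_append by auto
    let ?z = "\<lambda>k. if k \<in> L then g x u else z k"
    have "colored ?z x A u"
      using u(1) colored_off[of L A ?z z] new by auto
    moreover have "colored ?z u B x"
      using u(2) colored_off[of L B ?z z] new by auto
    moreover have "?z a = g x u" "?z b = g x u" using L by simp_all
    ultimately have "colored ?z x (S @ A @ T @ B) x"
      unfolding split by blast
    then show "\<exists>v. colored (\<lambda>k. if k \<in> L then v k else z k) x (S @ A @ T @ B) x"
      by (intro exI[of _ "\<lambda>_. g x u"]) simp
  next
    fix z' k
    assume p: "colored z x (S @ A @ T @ B) x" "colored z' x (S @ A @ T @ B) x"
      and e: "\<And>k. k \<notin> L \<Longrightarrow> z k = z' k" and k: "k \<in> L"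
    have *: "colored z x A u \<longleftrightarrow> colored z' x A u" for u
      using e new by (intro colored_off[of L]) auto
    from p obtain u u' where "colored z x A u" "z a = g x u" "z b = g x u"
      "colored z' x A u'" "z' a = g x u'" "z' b = g x u'"
      unfolding split by blast
    moreover from this have "u = u'" using * colored_unique by blast
    ultimately show "z k = z' k" using k L by auto
  }
qed

text \<open>
  If \<open>a\<close> and \<open>b\<close> are negative, the strand that comes first is the lower one.
\<close>

lemma num_colorings_r2:
  assumes ab: "(0 < a \<and> 0 < b) \<or> (a < 0 \<and> b < 0)" and new: "{\<bar>a\<bar>, \<bar>b\<bar>} \<inter> abs ` set (A @ B) = {}"
    and T: "T = [-a, -b] \<or> T = [-b, -a]"
  shows "num_colorings ([a, b] @ A @ T @ B) = num_colorings (A @ B)"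
  using ab
proof
  assume p: "0 < a \<and> 0 < b"
  show ?thesis
    by (rule num_colorings_r2_aux[where a = a and b = b and g = "\<lambda>x u. x" and L = "{a, b}"])
      (use p T new in \<open>auto simp: algebra_simps\<close>)
next
  assume p: "a < 0 \<and> b < 0"
  show ?thesis
    by (rule num_colorings_r2_aux[where a = "-a" and b = "-b" and g = "\<lambda>x u. u" and L = "{-a, -b}"])
      (use p T new in \<open>auto simp: algebra_simps\<close>)
qed

text \<open>
  The passages of the three strands of a third move, in either direction: the top strand runs over
  \<open>a\<close> and \<open>b\<close>, the middle strand under \<open>a\<close> and over \<open>c\<close>, and the bottom strand under \<open>b\<close> and \<open>c\<close>.
\<close>

definition triangle_segment :: "int \<Rightarrow> int \<Rightarrow> int \<Rightarrow> int list \<Rightarrow> bool" where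
  "triangle_segment a b c S \<longleftrightarrow> S \<in> {[a, b], [b, a], [-a, c], [c, -a], [-b, -c], [-c, -b]}"

lemma triangle_segment_rev: "triangle_segment a b c (rev S) \<longleftrightarrow> triangle_segment a b c S"
  unfolding triangle_segment_def by (auto simp: rev_swap)

lemma double_color: "2 * x = - (x :: color)"
proof -
  have "2 * x + x = (2 + 1) * x" by (simp only: distrib_right mult_1_left)
  also have "2 + 1 = (0 :: color)" by simp
  finally show ?thesis by (simp only: eq_neg_iff_add_eq_0 mult_zero_left)
qed

text \<open>
  Reversing the segments of a third move changes one overstrand colour only, that of the middle
  strand at \<open>c\<close>, which is reflected in the colour of the top strand.
\<close>

lemma colored_triangle:
  assumes "0 < a" "0 < b" "0 < c" "distinct [a, b, c]" "triangle_segment a b c S" "z a = z b"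
  shows "colored z x S y \<longleftrightarrow> colored (z(c := 2 * z a - z c)) x (rev S) y"
proof -
  consider "S = [a, b]" | "S = [b, a]" | "S = [-a, c]" | "S = [c, -a]" | "S = [-b, -c]" | "S = [-c, -b]"
    using assms(5) unfolding triangle_segment_def by blast
  then show ?thesis
  proof cases
    case 3
    have "2 * z b - x = z c \<longleftrightarrow> 2 * z b - z c = x" by (auto simp: algebra_simps)
    with 3 show ?thesis using assms by auto
  next
    case 4
    have "2 * z b - x = 2 * z b - z c \<longleftrightarrow> z c = x" by auto
    with 4 show ?thesis using assms by auto
  next
    case 5
    then show ?thesis using assms by (auto simp: double_color algebra_simps)
  next
    case 6
    then show ?thesis using assms by (auto simp: double_color algebra_simps)
  qed (use assms in auto)
qed

lemma colored_triangle_top: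
  assumes "0 < a" "0 < b" "set S = {a, b}" "triangle_segment a b c S" "colored z x S y"
  shows "z a = z b"
  using assms unfolding triangle_segment_def by (auto simp: doubleton_eq_iff)

lemma colored_segments:
  "colored z x (S1 @ A @ S2 @ B @ S3 @ C) y \<longleftrightarrow> (\<exists>x2 x3 y1 y2 y3. colored z x S1 y1 \<and>
     colored z x2 S2 y2 \<and> colored z x3 S3 y3 \<and> colored z y1 A x2 \<and> colored z y2 B x3 \<and> colored z y3 C y)"
  unfolding colored_append by blast

lemma num_colorings_r3:
  assumes abc: "0 < a" "0 < b" "0 < c" "distinct [a, b, c]"
    and tri: "\<forall>S \<in> {S1, S2, S3}. triangle_segment a b c S" and top: "\<exists>S \<in> {S1, S2, S3}. set S = {a, b}"
    and new: "c \<notin> abs ` set (A @ B @ C)"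
    and c: "c \<in> abs ` set (S1 @ S2 @ S3)"
  shows "num_colorings (S1 @ A @ S2 @ B @ S3 @ C) = num_colorings (rev S1 @ A @ rev S2 @ B @ rev S3 @ C)"
proof -
  let ?h = "\<lambda>(x :: color, z :: int \<Rightarrow> color). (x, z(c := 2 * z a - z c))"
  have h: "?h ` colorings (S1 @ A @ S2 @ B @ S3 @ C)
      \<subseteq> colorings (rev S1 @ A @ rev S2 @ B @ rev S3 @ C)"
    if tri: "\<forall>S \<in> {S1, S2, S3}. triangle_segment a b c S" and top: "\<exists>S \<in> {S1, S2, S3}. set S = {a, b}"
      and c: "c \<in> abs ` set (S1 @ S2 @ S3)" for S1 S2 S3
  proof clarify
    fix x z assume col: "(x, z) \<in> colorings (S1 @ A @ S2 @ B @ S3 @ C)"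
    let ?z = "z(c := 2 * z a - z c)"
    from col obtain x2 x3 y1 y2 y3
      where p: "colored z x S1 y1" "colored z x2 S2 y2" "colored z x3 S3 y3"
        and q: "colored z y1 A x2" "colored z y2 B x3" "colored z y3 C x"
      unfolding colorings_def mem_Collect_eq prod.case colored_segments by blast
    have "z a = z b" using colored_triangle_top[OF abc(1,2)] top tri p by blast
    then have "colored ?z x (rev S1) y1" "colored ?z x2 (rev S2) y2" "colored ?z x3 (rev S3) y3"
      using p tri colored_triangle[OF abc] by auto
    moreover have "colored ?z u W v \<longleftrightarrow> colored z u W v" if "W \<in> {A, B, C}" for W u v
      by (rule colored_cong) (use new that in auto)
    then have "colored ?z y1 A x2" "colored ?z y2 B x3" "colored ?z y3 C x"
      using q by auto
    ultimately have "colored ?z x (rev S1 @ A @ rev S2 @ B @ rev S3 @ C) x"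
      unfolding colored_segments by blast
    moreover have "\<forall>k. k \<notin> abs ` set (rev S1 @ A @ rev S2 @ B @ rev S3 @ C) \<longrightarrow> ?z k = 0"
      using col c unfolding colorings_def by auto
    ultimately show "(x, ?z) \<in> colorings (rev S1 @ A @ rev S2 @ B @ rev S3 @ C)"
      unfolding colorings_def by blast
  qed
  have inv: "\<forall>s. ?h (?h s) = s" using abc(4) by auto
  have 1: "?h ` colorings (S1 @ A @ S2 @ B @ S3 @ C)
      \<subseteq> colorings (rev S1 @ A @ rev S2 @ B @ rev S3 @ C)"
    using h[OF tri top c] .
  have 2: "?h ` colorings (rev S1 @ A @ rev S2 @ B @ rev S3 @ C)
      \<subseteq> colorings (S1 @ A @ S2 @ B @ S3 @ C)"
    using h[of "rev S1" "rev S2" "rev S3"] tri top c by (auto simp: triangle_segment_rev)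
  have "bij_betw ?h (colorings (S1 @ A @ S2 @ B @ S3 @ C))
      (colorings (rev S1 @ A @ rev S2 @ B @ rev S3 @ C))"
    by (rule bij_betw_byWitness[where f' = ?h]) (use inv 1 2 in blast)+
  then show ?thesis unfolding num_colorings_def by (rule bij_betw_same_card)
qed

lemma num_colorings_rotate: "num_colorings (w @ [a]) = num_colorings (a # w)"
proof -
  let ?n = "\<lambda>(x :: color, z). (if 0 < a then x else 2 * z \<bar>a\<bar> - x, z)"
  have eq: "abs ` set (w @ [a]) = abs ` set (a # w)" by auto
  have one: "colored z x [a] y \<longleftrightarrow> (0 < a \<longrightarrow> z \<bar>a\<bar> = x) \<and> ?n (x, z) = (y, z)" for x y z by simp
  have inv: "?n (?n s) = s" for s by (cases s) simp
  have 1: "?n ` colorings (a # w) \<subseteq> colorings (w @ [a])"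
  proof (rule image_subsetI)
    fix s assume "s \<in> colorings (a # w)"
    then obtain x z where s: "s = (x, z)" and c: "(x, z) \<in> colorings (a # w)" by (cases s) auto
    then obtain u where "colored z x [a] u" "colored z u w x"
      using colored_append[of z x "[a]" w x] unfolding colorings_def by auto
    then have "colored z u (w @ [a]) u" "?n (x, z) = (u, z)"
      unfolding colored_append one by auto
    then show "?n s \<in> colorings (w @ [a])"
      using c eq unfolding s colorings_def by auto
  qed
  have 2: "?n ` colorings (w @ [a]) \<subseteq> colorings (a # w)"
  proof (rule image_subsetI)
    fix s assume "s \<in> colorings (w @ [a])"
    then obtain u z where s: "s = (u, z)" and c: "(u, z) \<in> colorings (w @ [a])" by (cases s) auto
    then obtain x where p: "colored z u w x" "colored z x [a] u"
      unfolding colorings_def mem_Collect_eq prod.case colored_append by blast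
    then have "colored z x ([a] @ w) x" unfolding colored_append by blast
    moreover have "?n (u, z) = (x, z)"
      using p(2) inv[of "(x, z)"] unfolding one by auto
    ultimately show "?n s \<in> colorings (a # w)"
      using c eq unfolding s colorings_def by auto
  qed
  have "bij_betw ?n (colorings (w @ [a])) (colorings (a # w))"
    by (rule bij_betw_byWitness[where f' = ?n]) (use inv 1 2 in blast)+
  then show ?thesis unfolding num_colorings_def by (rule bij_betw_same_card)
qed

lemma num_colorings_relabel:
  assumes sgn: "\<And>a. a \<in> set w \<Longrightarrow> 0 < g a \<longleftrightarrow> 0 < a"
    and abs: "\<And>a. a \<in> set w \<Longrightarrow> \<bar>g a\<bar> = f \<bar>a\<bar>" and inj: "inj_on f (abs ` set w)"
  shows "num_colorings (map g w) = num_colorings w"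
proof -
  have colored: "colored z x (map g w) y \<longleftrightarrow> colored z' x w y"
    if "\<And>k. k \<in> abs ` set w \<Longrightarrow> z' k = z (f k)" for z z' x y
    using that sgn abs by (induction w arbitrary: x) auto
  have lab: "abs ` set (map g w) = f ` abs ` set w"
    using abs by (auto simp: image_image)
  let ?L = "abs ` set w"
  let ?p = "\<lambda>(x :: color, z :: int \<Rightarrow> color). (x, \<lambda>k. if k \<in> ?L then z (f k) else 0)"
  let ?q = "\<lambda>(x :: color, z :: int \<Rightarrow> color). (x, \<lambda>k. if k \<in> f ` ?L then z (the_inv_into ?L f k) else 0)"
  have "bij_betw ?p (colorings (map g w)) (colorings w)"
  proof (rule bij_betw_byWitness[where f' = ?q])
    show "\<forall>s \<in> colorings (map g w). ?q (?p s) = s"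
      using inj lab by (auto simp: colorings_def fun_eq_iff the_inv_into_f_f)
    show "\<forall>s \<in> colorings w. ?p (?q s) = s"
      using inj by (auto simp: colorings_def fun_eq_iff the_inv_into_f_f)
    show "?p ` colorings (map g w) \<subseteq> colorings w"
    proof clarify
      fix x z assume "(x, z) \<in> colorings (map g w)"
      then have "colored z x (map g w) x" by (simp add: colorings_def)
      then have "colored (\<lambda>k. if k \<in> ?L then z (f k) else 0) x w x"
        by (subst (asm) colored) auto
      then show "(x, \<lambda>k. if k \<in> ?L then z (f k) else 0) \<in> colorings w"
        by (simp add: colorings_def)
    qed
    show "?q ` colorings w \<subseteq> colorings (map g w)"
    proof clarify
      fix x z assume "(x, z) \<in> colorings w"
      then have p: "colored z x w x" by (simp add: colorings_def)
      have "colored (\<lambda>k. if k \<in> f ` ?L then z (the_inv_into ?L f k) else 0) x (map g w) x"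
        by (subst colored[of z]) (use p inj in \<open>auto simp: the_inv_into_f_f\<close>)
      then show "(x, \<lambda>k. if k \<in> f ` ?L then z (the_inv_into ?L f k) else 0) \<in> colorings (map g w)"
        unfolding colorings_def lab by simp
    qed
  qed
  then show ?thesis unfolding num_colorings_def by (rule bij_betw_same_card)
qed

section \<open>Indices of crossings and switching\<close>

text \<open>
  The change of the potential at an entry.  The factor \<open>\<omega>\<close> is \<open>1\<close> for the potential described
  above and \<open>0\<close> for the zero potential, with which no crossing is switched; this treats ordinary
  colourings and colourings of the switched code together.
\<close>

definition weight :: "int \<Rightarrow> int \<times> int \<Rightarrow> int" where
  "weight \<omega> = (\<lambda>(a, e). \<omega> * (sgn a * e))"

definition total :: "int \<Rightarrow> code \<Rightarrow> int" where
  "total \<omega> c = sum_list (map (weight \<omega>) c)"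

text \<open>
  \<open>potential \<omega> P s c\<close>: the strand enters \<open>c\<close> with potential \<open>s\<close>, and \<open>P a\<close> is the potential just
  before the entry labelled \<open>a\<close>.
\<close>

fun potential :: "int \<Rightarrow> (int \<Rightarrow> int) \<Rightarrow> int \<Rightarrow> code \<Rightarrow> bool" where
  "potential \<omega> P s [] \<longleftrightarrow> True"
| "potential \<omega> P s ((a, e) # c) \<longleftrightarrow> P a = s \<and> potential \<omega> P (s + \<omega> * (sgn a * e)) c"

text \<open>
  The term that is compared with \<open>0\<close> is the index of the crossing: the potential before the overpass
  minus the potential after the underpass.  The correction \<open>\<omega> * e\<close> makes the index of a kink \<open>0\<close>.
\<close>

definition switch_entry :: "int \<Rightarrow> (int \<Rightarrow> int) \<Rightarrow> int \<times> int \<Rightarrow> int" where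
  "switch_entry \<omega> P = (\<lambda>(a, e). if P \<bar>a\<bar> - P (- \<bar>a\<bar>) + \<omega> * e < 0 then - a else a)"

text \<open>
  The code in which all crossings of negative index are switched.  The potential is determined by the
  code up to a constant, which cancels in the indices, so the choice is immaterial (\<open>switched_eq\<close>).
\<close>

definition switched :: "int \<Rightarrow> code \<Rightarrow> int list" where
  "switched \<omega> c = map (switch_entry \<omega> (SOME P. potential \<omega> P 0 c)) c"

lemma total_simps [simp]:
  "total \<omega> [] = 0" "total \<omega> ((a, e) # c) = \<omega> * (sgn a * e) + total \<omega> c"
  "total \<omega> (c @ c') = total \<omega> c + total \<omega> c'"
  by (simp_all add: total_def weight_def)

lemma potential_append:
  "potential \<omega> P s (c @ c') \<longleftrightarrow> potential \<omega> P s c \<and> potential \<omega> P (s + total \<omega> c) c'"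
  by (induction \<omega> P s c rule: potential.induct) (auto simp: algebra_simps)

lemma potential_unique:
  "potential \<omega> P s c \<Longrightarrow> potential \<omega> Q t c \<Longrightarrow> a \<in> fst ` set c \<Longrightarrow> P a - Q a = s - t"
  by (induction \<omega> P s c arbitrary: t rule: potential.induct) fastforce+

lemma potential_cong:
  "(\<And>a. a \<in> fst ` set c \<Longrightarrow> P a = Q a) \<Longrightarrow> potential \<omega> P s c \<longleftrightarrow> potential \<omega> Q s c"
  by (induction \<omega> P s c rule: potential.induct) auto

lemma potential_exists: "distinct (map fst c) \<Longrightarrow> \<exists>P. potential \<omega> P s c"
proof (induction c arbitrary: s)
  case (Cons x c)
  obtain a e where x: "x = (a, e)" by (cases x)
  with Cons obtain P where P: "potential \<omega> P (s + \<omega> * (sgn a * e)) c" by auto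
  have "potential \<omega> (P(a := s)) (s + \<omega> * (sgn a * e)) c"
    using P Cons.prems x by (subst potential_cong[of _ _ P]) auto
  then have "potential \<omega> (P(a := s)) s (x # c)" using x by simp
  then show ?case by blast
qed simp

lemma switched_eq:
  assumes dist: "distinct (map fst c)" and sym: "\<And>a. a \<in> fst ` set c \<Longrightarrow> - a \<in> fst ` set c"
    and P: "potential \<omega> P s c"
  shows "switched \<omega> c = map (switch_entry \<omega> P) c"
proof -
  let ?Q = "SOME P. potential \<omega> P 0 c"
  have Q: "potential \<omega> ?Q 0 c" using someI_ex[OF potential_exists[OF dist]] .
  have "switch_entry \<omega> ?Q x = switch_entry \<omega> P x" if "x \<in> set c" for x
  proof -
    obtain a e where x: "x = (a, e)" by (cases x)
    have "a \<in> fst ` set c" "- a \<in> fst ` set c" using that x sym by force+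
    then have "P \<bar>a\<bar> - ?Q \<bar>a\<bar> = s - 0" "P (- \<bar>a\<bar>) - ?Q (- \<bar>a\<bar>) = s - 0"
      using potential_unique[OF P Q] by (auto simp: abs_if)
    then have "?Q \<bar>a\<bar> - ?Q (- \<bar>a\<bar>) = P \<bar>a\<bar> - P (- \<bar>a\<bar>)" by linarith
    then show ?thesis unfolding switch_entry_def x by simp
  qed
  then show ?thesis unfolding switched_def by simp
qed

lemma switch_entry_cong:
  "P \<bar>fst x\<bar> = Q \<bar>fst x\<bar> \<Longrightarrow> P (- \<bar>fst x\<bar>) = Q (- \<bar>fst x\<bar>) \<Longrightarrow> switch_entry \<omega> P x = switch_entry \<omega> Q x"
  unfolding switch_entry_def by (cases x) simp

lemma abs_switch_entry [simp]: "\<bar>switch_entry \<omega> P x\<bar> = \<bar>fst x\<bar>"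
  unfolding switch_entry_def by (cases x) auto

lemma switch_entry_cases: "switch_entry \<omega> P x = fst x \<or> switch_entry \<omega> P x = - fst x"
  unfolding switch_entry_def by (cases x) simp

lemma abs_map_switch_entry: "abs ` set (map (switch_entry \<omega> P) c) = abs ` fst ` set c"
  by (simp add: image_image)

lemma switch_entry_neg: "switch_entry \<omega> P (- a, e) = - switch_entry \<omega> P (a, e)"
  unfolding switch_entry_def by auto

lemma gauss_code_facts:
  assumes "gauss_code c"
  shows "distinct (map fst c)" "a \<in> fst ` set c \<Longrightarrow> - a \<in> fst ` set c"
    "a \<in> fst ` set c \<Longrightarrow> a \<noteq> 0" "(a, e) \<in> set c \<Longrightarrow> (- a, e) \<in> set c"
proof -
  note G = assms[unfolded gauss_code_def]
  show 1: "distinct (map fst c)" using G by (rule conjunct1)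
  obtain k :: nat where k: "fst ` set c = {a. 1 \<le> \<bar>a\<bar> \<and> \<bar>a\<bar> \<le> int k}"
    using conjunct1[OF conjunct2[OF G]] by (rule exE)
  show 2: "a \<in> fst ` set c \<Longrightarrow> - a \<in> fst ` set c" for a unfolding k by simp
  show "a \<in> fst ` set c \<Longrightarrow> a \<noteq> 0" unfolding k by auto
  show "(- a, e) \<in> set c" if "(a, e) \<in> set c"
  proof -
    from that 2[of a] obtain f where f: "(- a, f) \<in> set c" by force
    have "\<forall>(a, e) \<in> set c. \<forall>(b, f) \<in> set c. \<bar>a\<bar> = \<bar>b\<bar> \<longrightarrow> e = f"
      using conjunct2[OF conjunct2[OF conjunct2[OF G]]] .
    with that f have "e = f" by fastforce
    with f show ?thesis by simp
  qed
qed

lemma total_gauss_code: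
  assumes "gauss_code c"
  shows "total \<omega> c = 0"
proof -
  have "distinct c" using gauss_code_facts(1)[OF assms] by (simp add: distinct_map)
  then have t: "total \<omega> c = (\<Sum>x\<in>set c. weight \<omega> x)"
    unfolding total_def by (rule sum_list_distinct_conv_sum_set)
  also have "\<dots> = (\<Sum>x\<in>set c. - weight \<omega> x)"
    by (rule sum.reindex_bij_witness[where i = "\<lambda>(a, e). (- a, e)" and j = "\<lambda>(a, e). (- a, e)"])
      (use gauss_code_facts(4)[OF assms] in \<open>auto simp: weight_def sgn_if\<close>)
  finally have "total \<omega> c = - total \<omega> c" unfolding t by (simp add: sum_negf)
  then show ?thesis by simp
qed

text \<open>
  The number of 3-colourings of the switched code.
\<close>

definition index_colorings :: "int \<Rightarrow> code \<Rightarrow> nat" where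
  "index_colorings \<omega> c = num_colorings (switched \<omega> c)"

lemma index_colorings_eq: "gauss_code c \<Longrightarrow> potential \<omega> P s c \<Longrightarrow> index_colorings \<omega> c = num_colorings (map (switch_entry \<omega> P) c)"
  unfolding index_colorings_def using switched_eq gauss_code_facts(1,2) by metis

lemma gauss_potential: "gauss_code c \<Longrightarrow> \<exists>P. potential \<omega> P 0 c"
  using potential_exists gauss_code_facts(1) by blast

lemma index_colorings_rotate:
  assumes "gauss_code c" "gauss_code (rotate1 c)"
  shows "index_colorings \<omega> (rotate1 c) = index_colorings \<omega> c"
proof (cases c)
  case (Cons x w)
  obtain a e where x: "x = (a, e)" by (cases x)
  obtain P where P: "potential \<omega> P 0 c" using gauss_potential[OF assms(1)] by blast
  have "total \<omega> c = 0" using total_gauss_code[OF assms(1)] .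
  then have Q: "potential \<omega> P (\<omega> * (sgn a * e)) (rotate1 c)"
    using P Cons x by (simp add: potential_append)
  show ?thesis
    unfolding index_colorings_eq[OF assms(1) P] index_colorings_eq[OF assms(2) Q] using Cons by (simp add: num_colorings_rotate)
qed simp

lemma index_colorings_relabel:
  assumes g: "gauss_code c" "gauss_code c'" and inj: "inj f"
    and c': "c' = map (\<lambda>(a, e). (sgn a * int (f (nat \<bar>a\<bar>)), e)) c"
  shows "index_colorings \<omega> c' = index_colorings \<omega> c"
proof -
  define h where "h a = sgn a * int (f (nat \<bar>a\<bar>))" for a :: int
  have c'h: "c' = map (\<lambda>(a, e). (h a, e)) c" using c' unfolding h_def .
  obtain P where P: "potential \<omega> P 0 c'" using gauss_potential[OF g(2)] by blast
  have pos: "0 < f (nat \<bar>a\<bar>)" if "a \<in> fst ` set c" for a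
  proof -
    have "h a \<in> fst ` set c'" using that unfolding c'h by force
    then have "h a \<noteq> 0" using gauss_code_facts(3)[OF g(2)] by blast
    then show ?thesis unfolding h_def by (cases "f (nat \<bar>a\<bar>)") auto
  qed
  have sgn: "sgn (h a) = sgn a" if "a \<in> fst ` set c" for a
    using pos[OF that] unfolding h_def by (simp add: sgn_mult)
  have abs: "\<bar>h a\<bar> = h \<bar>a\<bar>" "h (- a) = - h a" if "a \<in> fst ` set c" for a
    using gauss_code_facts(3)[OF g(1) that] unfolding h_def by (auto simp: abs_mult sgn_if)
  have Q: "potential \<omega> (P \<circ> h) s c" if "potential \<omega> P s (map (\<lambda>(a, e). (h a, e)) c)"
    "fst ` set c \<subseteq> X" "\<And>a. a \<in> X \<Longrightarrow> sgn (h a) = sgn a" for s c X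
    using that by (induction c arbitrary: s) auto
  have Q: "potential \<omega> (P \<circ> h) 0 c"
    using Q[of 0 c "fst ` set c"] P sgn unfolding c'h by blast
  have ov: "switch_entry \<omega> P (h a, e) = h (switch_entry \<omega> (P \<circ> h) (a, e))" if "(a, e) \<in> set c" for a e
  proof -
    have a: "a \<in> fst ` set c" using that by force
    have "h (- \<bar>a\<bar>) = - h \<bar>a\<bar>" unfolding h_def by (simp add: sgn_if)
    then show ?thesis using abs[OF a] unfolding switch_entry_def by simp
  qed
  have "map (switch_entry \<omega> P) c' = map h (map (switch_entry \<omega> (P \<circ> h)) c)"
    unfolding c'h using ov by auto
  moreover have "num_colorings (map h (map (switch_entry \<omega> (P \<circ> h)) c)) = num_colorings (map (switch_entry \<omega> (P \<circ> h)) c)"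
  proof (rule num_colorings_relabel[where f = h])
    fix b assume "b \<in> set (map (switch_entry \<omega> (P \<circ> h)) c)"
    then obtain x where x: "x \<in> set c" "b = switch_entry \<omega> (P \<circ> h) x" by auto
    then have "b = fst x \<or> b = - fst x" using switch_entry_cases by blast
    then have b: "b \<in> fst ` set c" using x(1) gauss_code_facts(2)[OF g(1)] by auto
    show "0 < h b \<longleftrightarrow> 0 < b" using sgn[OF b] by (metis sgn_greater)
    show "\<bar>h b\<bar> = h \<bar>b\<bar>" using abs[OF b] by simp
  next
    show "inj_on h (abs ` set (map (switch_entry \<omega> (P \<circ> h)) c))"
    proof (rule inj_onI)
      fix k l assume k: "k \<in> abs ` set (map (switch_entry \<omega> (P \<circ> h)) c)"
        and l: "l \<in> abs ` set (map (switch_entry \<omega> (P \<circ> h)) c)" and eq: "h k = h l"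
      have "0 < i" if "i \<in> abs ` set (map (switch_entry \<omega> (P \<circ> h)) c)" for i
      proof -
        have "i \<in> abs ` fst ` set c" using that unfolding abs_map_switch_entry .
        then obtain a where "i = \<bar>a\<bar>" "a \<in> fst ` set c" by (rule imageE)
        then show ?thesis using gauss_code_facts(3)[OF g(1)] by simp
      qed
      from this[OF k] this[OF l] have kl: "0 < k" "0 < l" .
      then have "f (nat k) = f (nat l)" using eq unfolding h_def by simp
      then have "nat k = nat l" by (rule injD[OF inj])
      then show "k = l" using kl by simp
    qed
  qed
  ultimately show ?thesis
    unfolding index_colorings_eq[OF g(1) Q] index_colorings_eq[OF g(2) P] by simp
qed

lemma abs_disjoint: "X \<inter> {a, - a} = {} \<Longrightarrow> \<bar>a\<bar> \<notin> abs ` (X :: int set)"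
  by (auto simp: abs_eq_iff)

lemma distinct_disjoint:
  "distinct (t1 @ w1 @ t2 @ w2 @ t3 @ w3) \<Longrightarrow>
    set (w1 @ w2 @ w3) \<inter> (set t1 \<union> set t2 \<union> set t3) = {}"
  by auto

lemma distinct_parts:
  assumes "distinct (t1 @ w1 @ t2 @ w2 @ t3 @ w3)"
  shows "distinct t1" "distinct t2" "distinct t3" "set t1 \<inter> set t2 = {}" "set t1 \<inter> set t3 = {}"
  using assms by auto

lemma distinct_disjoint2:
  "distinct (t1 @ w1 @ t2 @ w2) \<Longrightarrow> set (w1 @ w2) \<inter> (set t1 \<union> set t2) = {}"
  by auto

lemma index_colorings_r1:
  assumes g: "gauss_code (A @ B)" "gauss_code (A @ [(a, e), (- a, e)] @ B)"
  shows "index_colorings \<omega> (A @ [(a, e), (- a, e)] @ B) = index_colorings \<omega> (A @ B)"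
proof -
  obtain P where P: "potential \<omega> P 0 (A @ [(a, e), (- a, e)] @ B)"
    using gauss_potential[OF g(2)] by blast
  then have Q: "potential \<omega> P 0 (A @ B)"
    by (simp add: potential_append sgn_if split: if_splits)
  have "a \<in> fst ` set (A @ [(a, e), (- a, e)] @ B)" by simp
  then have a: "a \<noteq> 0" using gauss_code_facts(3)[OF g(2)] by blast
  have new: "\<bar>a\<bar> \<notin> abs ` fst ` set (A @ B)"
  proof (rule abs_disjoint)
    have "set (map fst A @ map fst B) \<inter> (set [] \<union> set [a, - a]) = {}"
      by (rule distinct_disjoint2) (use gauss_code_facts(1)[OF g(2)] in simp)
    then show "fst ` set (A @ B) \<inter> {a, - a} = {}"
      by (simp only: set_append set_map image_Un list.set Un_empty_left)
  qed
  let ?b = "switch_entry \<omega> P (a, e)"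
  have "num_colorings (map (switch_entry \<omega> P) A @ [?b, - ?b] @ map (switch_entry \<omega> P) B)
      = num_colorings (map (switch_entry \<omega> P) A @ map (switch_entry \<omega> P) B)"
  proof (rule num_colorings_r1)
    show "?b \<noteq> 0" using a abs_switch_entry[of \<omega> P "(a, e)"] by force
    show "\<bar>?b\<bar> \<notin> abs ` set (map (switch_entry \<omega> P) A @ map (switch_entry \<omega> P) B)"
      unfolding map_append[symmetric] abs_map_switch_entry using new by simp
  qed
  then show ?thesis
    unfolding index_colorings_eq[OF g(1) Q] index_colorings_eq[OF g(2) P] by (simp add: switch_entry_neg)
qed

lemma index_colorings_r2:
  assumes g: "gauss_code (A @ B)" "gauss_code ([(a, e), (b, - e)] @ A @ T @ B)"
    and T: "T = [(- a, e), (- b, - e)] \<or> T = [(- b, - e), (- a, e)]"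
    and pos: "0 < a" "0 < b"
  shows "index_colorings \<omega> ([(a, e), (b, - e)] @ A @ T @ B) = index_colorings \<omega> (A @ B)"
proof -
  obtain P where P: "potential \<omega> P 0 ([(a, e), (b, - e)] @ A @ T @ B)"
    using gauss_potential[OF g(2)] by blast
  have Q: "potential \<omega> P 0 (A @ B)"
    using P T pos by (auto simp: potential_append)
  have new: "{\<bar>a\<bar>, \<bar>b\<bar>} \<inter> abs ` fst ` set (A @ B) = {}"
  proof -
    have "set (map fst A @ map fst B) \<inter> (set [a, b] \<union> set (map fst T)) = {}"
      by (rule distinct_disjoint2) (use gauss_code_facts(1)[OF g(2)] in simp)
    then have "fst ` set (A @ B) \<inter> (set [a, b] \<union> fst ` set T) = {}"
      by (simp only: set_append set_map image_Un)
    moreover have "set [a, b] \<union> fst ` set T = {a, b, - a, - b}" using T by auto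
    ultimately have "fst ` set (A @ B) \<inter> {a, - a} = {}" "fst ` set (A @ B) \<inter> {b, - b} = {}"
      by blast+
    then show ?thesis using abs_disjoint by blast
  qed
  have index: "P a - P (- a) + \<omega> * e = P b - P (- b) + \<omega> * - e"
    using P T pos by (auto simp: potential_append)
  let ?a = "switch_entry \<omega> P (a, e)" and ?b = "switch_entry \<omega> P (b, - e)"
  have ab: "\<bar>?a\<bar> = a" "\<bar>?b\<bar> = b" using pos by auto
  have "num_colorings ([?a, ?b] @ map (switch_entry \<omega> P) A @ map (switch_entry \<omega> P) T @ map (switch_entry \<omega> P) B)
      = num_colorings (map (switch_entry \<omega> P) A @ map (switch_entry \<omega> P) B)"
  proof (rule num_colorings_r2)
    show "(0 < ?a \<and> 0 < ?b) \<or> (?a < 0 \<and> ?b < 0)"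
      using pos index unfolding switch_entry_def by auto
    have "abs ` set (map (switch_entry \<omega> P) A @ map (switch_entry \<omega> P) B) = abs ` fst ` set (A @ B)"
      unfolding map_append[symmetric] abs_map_switch_entry ..
    then show "{\<bar>?a\<bar>, \<bar>?b\<bar>} \<inter> abs ` set (map (switch_entry \<omega> P) A @ map (switch_entry \<omega> P) B) = {}"
      using new ab pos by simp
    show "map (switch_entry \<omega> P) T = [- ?a, - ?b] \<or> map (switch_entry \<omega> P) T = [- ?b, - ?a]"
      using T by (auto simp: switch_entry_neg)
  qed
  then show ?thesis
    unfolding index_colorings_eq[OF g(1) Q] index_colorings_eq[OF g(2) P] by simp
qed

text \<open>
  The indices of the three crossings do not change, and that of \<open>b\<close> is the sum of those of \<open>a\<close> and
  \<open>c\<close>.  Hence \<open>b\<close> is switched if \<open>a\<close> and \<open>c\<close> are and is not switched if neither is.  In each of the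
  six remaining cases the switched segments are those of a third move with permuted strands.
\<close>

lemma index_colorings_r3:
  assumes \<omega>: "\<omega> \<in> {0, 1}" and seg: "r3_segments S1 S2 S3"
    and T: "(T1, T2, T3) = (S1, S2, S3) \<or> (T1, T2, T3) = (S1, S3, S2)"
    and g: "gauss_code (T1 @ A @ T2 @ B @ T3 @ C)" "gauss_code (rev T1 @ A @ rev T2 @ B @ rev T3 @ C)"
  shows "index_colorings \<omega> (rev T1 @ A @ rev T2 @ B @ rev T3 @ C) = index_colorings \<omega> (T1 @ A @ T2 @ B @ T3 @ C)"
proof -
  let ?c = "T1 @ A @ T2 @ B @ T3 @ C" and ?c' = "rev T1 @ A @ rev T2 @ B @ rev T3 @ C"
  obtain a b c o1 o2 o3 d where abc: "0 < a" "0 < b" "0 < c"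
    and od: "{o1, o2, o3, d} \<subseteq> {1, -1}"
    and S1: "S1 = directed o1 (a, o1 * o2 * d) (b, o1 * o3 * d)"
    and S2: "S2 = directed o2 (- a, o1 * o2 * d) (c, o2 * o3 * d)"
    and S3: "S3 = directed o3 (- b, o1 * o3 * d) (- c, o2 * o3 * d)"
    using seg by (cases rule: r3_segments.cases) auto
  obtain P where P: "potential \<omega> P 0 ?c" using gauss_potential[OF g(1)] by blast
  obtain Q where Q: "potential \<omega> Q 0 ?c'" using gauss_potential[OF g(2)] by blast
  have dist: "distinct (map fst ?c)" using gauss_code_facts(1)[OF g(1)] .
  have setS: "fst ` set S1 = {a, b}" "fst ` set S2 = {- a, c}" "fst ` set S3 = {- b, - c}"
    unfolding S1 S2 S3 directed_def by auto
  have setT: "fst ` set T1 \<union> fst ` set T2 \<union> fst ` set T3 = {a, b, c, - a, - b, - c}"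
    using T setS by auto
  have "fst ` set (A @ B @ C) \<inter> (fst ` set T1 \<union> fst ` set T2 \<union> fst ` set T3) = {}"
    using distinct_disjoint[of "map fst T1" "map fst A" "map fst T2" "map fst B" "map fst T3" "map fst C"]
      dist by (simp only: map_append set_append set_map image_Un)
  then have new: "fst ` set (A @ B @ C) \<inter> {a, b, c, - a, - b, - c} = {}"
    unfolding setT .
  have "distinct (map fst T1 @ map fst A @ map fst T2 @ map fst B @ map fst T3 @ map fst C)"
    using dist by simp
  note distinct_parts[OF this]
  then have "distinct (map fst S1)" "distinct (map fst S3)" "set (map fst S1) \<inter> set (map fst S2) = {}"
    using T by auto
  then have "a \<noteq> b" "b \<noteq> c" "a \<noteq> c"
    unfolding S1 S2 S3 directed_def by (auto split: if_splits)
  then have abc': "distinct [a, b, c]" by simp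
  have tot: "total \<omega> (rev S) = total \<omega> S" for S
    unfolding total_def by (simp add: rev_map[symmetric] sum_list_rev)
  define t1 t2 t3 where "t1 = (0::int)" and "t2 = total \<omega> T1 + total \<omega> A"
    and "t3 = total \<omega> T1 + total \<omega> A + total \<omega> T2 + total \<omega> B"
  have PT: "potential \<omega> P t1 T1" "potential \<omega> P t2 T2" "potential \<omega> P t3 T3"
    and PA: "potential \<omega> P (t1 + total \<omega> T1) A" "potential \<omega> P (t2 + total \<omega> T2) B"
      "potential \<omega> P (t3 + total \<omega> T3) C"
    using P unfolding t1_def t2_def t3_def by (auto simp: potential_append add_ac)
  have QT: "potential \<omega> Q t1 (rev T1)" "potential \<omega> Q t2 (rev T2)" "potential \<omega> Q t3 (rev T3)"
    and QA: "potential \<omega> Q (t1 + total \<omega> T1) A" "potential \<omega> Q (t2 + total \<omega> T2) B"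
      "potential \<omega> Q (t3 + total \<omega> T3) C"
    using Q unfolding t1_def t2_def t3_def by (auto simp: potential_append add_ac tot)
  have PQ: "P k = Q k" if "k \<in> fst ` set (A @ B @ C)" for k
  proof -
    have "k \<in> fst ` set A \<or> k \<in> fst ` set B \<or> k \<in> fst ` set C" using that by auto
    then have "P k - Q k = 0"
      using potential_unique[OF PA(1) QA(1)] potential_unique[OF PA(2) QA(2)]
        potential_unique[OF PA(3) QA(3)] by (elim disjE) simp_all
    then show ?thesis by simp
  qed
  have "\<exists>s1 s2 s3. potential \<omega> P s1 S1 \<and> potential \<omega> P s2 S2 \<and> potential \<omega> P s3 S3 \<and>
      potential \<omega> Q s1 (rev S1) \<and> potential \<omega> Q s2 (rev S2) \<and> potential \<omega> Q s3 (rev S3)"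
    using T PT QT by auto
  then obtain s1 s2 s3 where PS: "potential \<omega> P s1 S1" "potential \<omega> P s2 S2" "potential \<omega> P s3 S3"
    and QS: "potential \<omega> Q s1 (rev S1)" "potential \<omega> Q s2 (rev S2)" "potential \<omega> Q s3 (rev S3)"
    by blast
  have od': "(o1 = 1 \<or> o1 = -1) \<and> (o2 = 1 \<or> o2 = -1) \<and> (o3 = 1 \<or> o3 = -1) \<and> (d = 1 \<or> d = -1)"
    using od by auto
  have sg: "sgn a = 1" "sgn b = 1" "sgn c = 1" using abc by auto
  \<comment> \<open>A computation for each of the sixteen choices of orientations.\<close>
  have same: "P a - P (- a) = Q a - Q (- a)" "P b - P (- b) = Q b - Q (- b)"
      "P c - P (- c) = Q c - Q (- c)"
    and sum: "P b - P (- b) + \<omega> * (o1 * o3 * d) =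
      (P a - P (- a) + \<omega> * (o1 * o2 * d)) + (P c - P (- c) + \<omega> * (o2 * o3 * d))"
    using PS QS od' unfolding S1 S2 S3 directed_def by (auto simp: sg)
  have rest: "map (switch_entry \<omega> Q) W = map (switch_entry \<omega> P) W" if "set W \<subseteq> set (A @ B @ C)" for W
  proof (rule map_cong[OF refl])
    fix x assume "x \<in> set W"
    then have x: "fst x \<in> fst ` set (A @ B @ C)" using that by auto
    then have "fst x \<in> fst ` set ?c" by auto
    then have "- fst x \<in> fst ` set ?c" using gauss_code_facts(2)[OF g(1)] by blast
    moreover have "fst x \<notin> {a, b, c, - a, - b, - c}" using new x by blast
    then have "- fst x \<notin> {a, b, c, - a, - b, - c}" by (simp add: minus_equation_iff eq_commute)
    ultimately have "- fst x \<in> fst ` set (A @ B @ C)" unfolding setT[symmetric] by auto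
    then show "switch_entry \<omega> Q x = switch_entry \<omega> P x"
      using PQ x by (intro switch_entry_cong) (auto simp: abs_if)
  qed
  have "switch_entry \<omega> Q x = switch_entry \<omega> P x" if "x \<in> set S1 \<union> set S2 \<union> set S3" for x
    using that same abc unfolding S1 S2 S3 directed_def switch_entry_def by (auto split: if_splits)
  then have mT: "map (switch_entry \<omega> Q) (rev W) = rev (map (switch_entry \<omega> P) W)" if "W \<in> {T1, T2, T3}" for W
    using that T by (auto simp: rev_map)
  let ?m = "map (switch_entry \<omega> P)"
  have step: "num_colorings (?m T1 @ ?m A @ ?m T2 @ ?m B @ ?m T3 @ ?m C) =
      num_colorings (rev (?m T1) @ ?m A @ rev (?m T2) @ ?m B @ rev (?m T3) @ ?m C)"
    if "0 < u" "0 < v" "0 < w" "distinct [u, v, w]" "w \<in> {a, b, c}"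
      "\<forall>S \<in> {?m S1, ?m S2, ?m S3}. triangle_segment u v w S" "\<exists>S \<in> {?m S1, ?m S2, ?m S3}. set S = {u, v}"
    for u v w
  proof (rule num_colorings_r3[OF that(1-4)])
    show "\<forall>S \<in> {?m T1, ?m T2, ?m T3}. triangle_segment u v w S" using that(6) T by auto
    show "\<exists>S \<in> {?m T1, ?m T2, ?m T3}. set S = {u, v}" using that(7) T by auto
    have "fst ` set (A @ B @ C) \<inter> {w, - w} = {}" using new that(5) by auto
    then have "\<bar>w\<bar> \<notin> abs ` fst ` set (A @ B @ C)" by (rule abs_disjoint)
    then show "w \<notin> abs ` set (?m A @ ?m B @ ?m C)"
      unfolding map_append[symmetric] abs_map_switch_entry using that(3) by simp
    have "w \<in> fst ` set (T1 @ T2 @ T3)" using that(5) setT by (auto simp: image_Un)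
    then have "\<bar>w\<bar> \<in> abs ` fst ` set (T1 @ T2 @ T3)" by (rule imageI)
    then show "w \<in> abs ` set (?m T1 @ ?m T2 @ ?m T3)"
      unfolding map_append[symmetric] abs_map_switch_entry using that(3) by simp
  qed
  define fa fb fc where "fa \<longleftrightarrow> P a - P (- a) + \<omega> * (o1 * o2 * d) < 0"
    and "fb \<longleftrightarrow> P b - P (- b) + \<omega> * (o1 * o3 * d) < 0"
    and "fc \<longleftrightarrow> P c - P (- c) + \<omega> * (o2 * o3 * d) < 0"
  have trans: "fa = fc \<Longrightarrow> fb = fa" unfolding fa_def fb_def fc_def using sum by auto
  have dir: "?m (directed s x y) = directed s (switch_entry \<omega> P x) (switch_entry \<omega> P y)" for s x y
    unfolding directed_def by simp
  have m: "?m S1 = directed o1 (if fa then - a else a) (if fb then - b else b)"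
    "?m S2 = directed o2 (if fa then a else - a) (if fc then - c else c)"
    "?m S3 = directed o3 (if fb then b else - b) (if fc then c else - c)"
    unfolding S1 S2 S3 dir using abc by (simp_all add: fa_def fb_def fc_def switch_entry_def)
  have eq: "num_colorings (?m T1 @ ?m A @ ?m T2 @ ?m B @ ?m T3 @ ?m C) =
      num_colorings (rev (?m T1) @ ?m A @ rev (?m T2) @ ?m B @ rev (?m T3) @ ?m C)"
  proof -
    consider "\<not> fa" "\<not> fb" "\<not> fc" | "fa" "fb" "fc" | "fa" "\<not> fb" "\<not> fc" | "fa" "fb" "\<not> fc"
      | "\<not> fa" "\<not> fb" "fc" | "\<not> fa" "fb" "fc"
      using trans by auto
    then show ?thesis
    proof cases
      case 1
      then show ?thesis
        by (intro step[of a b c]) (use abc abc' in \<open>auto simp: m triangle_segment_def directed_def\<close>)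
    next
      case 2
      then show ?thesis
        by (intro step[of c b a]) (use abc abc' in \<open>auto simp: m triangle_segment_def directed_def\<close>)
    next
      case 3
      then show ?thesis
        by (intro step[of a c b]) (use abc abc' in \<open>auto simp: m triangle_segment_def directed_def\<close>)
    next
      case 4
      then show ?thesis
        by (intro step[of c a b]) (use abc abc' in \<open>auto simp: m triangle_segment_def directed_def\<close>)
    next
      case 5
      then show ?thesis
        by (intro step[of b a c]) (use abc abc' in \<open>auto simp: m triangle_segment_def directed_def\<close>)
    next
      case 6
      then show ?thesis
        by (intro step[of b c a]) (use abc abc' in \<open>auto simp: m triangle_segment_def directed_def\<close>)
    qed
  qed
  have ABC: "map (switch_entry \<omega> Q) A = ?m A" "map (switch_entry \<omega> Q) B = ?m B"
    "map (switch_entry \<omega> Q) C = ?m C" by (rule rest; auto)+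
  have TTT: "map (switch_entry \<omega> Q) (rev T1) = rev (?m T1)" "map (switch_entry \<omega> Q) (rev T2) = rev (?m T2)"
    "map (switch_entry \<omega> Q) (rev T3) = rev (?m T3)" by (rule mT; simp)+
  show ?thesis
    unfolding index_colorings_eq[OF g(1) P] index_colorings_eq[OF g(2) Q] map_append ABC TTT by (rule eq[symmetric])
qed

lemma index_colorings_move:
  assumes "\<omega> \<in> {0, 1}" "code_move c c'"
  shows "index_colorings \<omega> c' = index_colorings \<omega> c"
proof -
  have g: "gauss_code c" "gauss_code c'" "raw_move c c'"
    using assms(2) unfolding code_move_def by auto
  from g(3,1,2) show ?thesis
  proof (cases rule: raw_move.cases)
    case rotate
    then show ?thesis using g index_colorings_rotate by blast
  next
    case (relabel f)
    then show ?thesis using g index_colorings_relabel by blast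
  next
    case (r1 A B a e)
    then show ?thesis using g index_colorings_r1 by blast
  next
    case (r2_parallel a b A B e)
    then show ?thesis using g index_colorings_r2[of A B a e b "[(- a, e), (- b, - e)]"] by blast
  next
    case (r2_antiparallel a b A B e)
    then show ?thesis using g index_colorings_r2[of A B a e b "[(- b, - e), (- a, e)]"] by blast
  next
    case (r3_top_middle_bottom S1 S2 S3 A B C)
    then show ?thesis using g index_colorings_r3[OF assms(1), of S1 S2 S3 S1 S2 S3 A B C] by blast
  next
    case (r3_top_bottom_middle S1 S2 S3 A B C)
    then show ?thesis using g index_colorings_r3[OF assms(1), of S1 S2 S3 S1 S3 S2 A B C] by blast
  qed
qed

lemma index_colorings_equiv:
  assumes "\<omega> \<in> {0, 1}" "(c, c') \<in> code_equiv"
  shows "index_colorings \<omega> c' = index_colorings \<omega> c"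
proof -
  have "equivclp code_move c c'" using assms(2) unfolding code_equiv_def by blast
  then show ?thesis
    by (induction rule: equivclp_induct) (use index_colorings_move[OF assms(1)] in auto)
qed

section \<open>Bounds on the number of colourings\<close>

text \<open>
  The colour with which a strand leaves \<open>w\<close> if the conditions at the overpasses are disregarded.
\<close>

fun run_color :: "(int \<Rightarrow> color) \<Rightarrow> color \<Rightarrow> int list \<Rightarrow> color" where
  "run_color z x [] = x"
| "run_color z x (a # w) = run_color z (if 0 < a then x else 2 * z \<bar>a\<bar> - x) w"

lemma colored_run_color: "colored z x w y \<Longrightarrow> run_color z x w = y"
  by (induction w arbitrary: x) (auto split: if_splits)

text \<open>
  The same colourings, now as functions on arcs: \<open>\<xi> i\<close> is the colour of the arc before the entry at
  position \<open>i\<close>, and positions are read cyclically.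
\<close>

definition arc_coloring :: "int list \<Rightarrow> (int \<Rightarrow> color) \<Rightarrow> (nat \<Rightarrow> color) \<Rightarrow> bool" where
  "arc_coloring w z \<xi> \<longleftrightarrow> (\<forall>i < length w. let x = \<xi> i; y = \<xi> (Suc i mod length w); c = z \<bar>w ! i\<bar> in
     if 0 < w ! i then x = c \<and> y = c else x + y = 2 * c)"

lemma arc_coloring_run_color:
  assumes "colored z x w x"
  shows "arc_coloring w z (\<lambda>i. run_color z x (take i w))"
proof -
  have "let x' = run_color z x (take i w); y = run_color z x (take (Suc i mod length w) w); c = z \<bar>w ! i\<bar> in
     if 0 < w ! i then x' = c \<and> y = c else x' + y = 2 * c" if i: "i < length w" for i
  proof -
    have "colored z x (take (Suc i) w @ drop (Suc i) w) x" using assms by simp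
    then obtain v where v: "colored z x (take (Suc i) w) v" "colored z v (drop (Suc i) w) x"
      unfolding colored_append by blast
    then obtain u where u: "colored z x (take i w) u" "colored z u [w ! i] v"
      unfolding take_Suc_conv_app_nth[OF i] colored_append by blast
    have "run_color z x (take (Suc i mod length w) w) = v"
    proof (cases "Suc i = length w")
      case True
      then have "v = x" using v(2) by simp
      then show ?thesis using True by simp
    next
      case False
      then show ?thesis using i colored_run_color[OF v(1)] by simp
    qed
    moreover have "run_color z x (take i w) = u" using colored_run_color[OF u(1)] .
    moreover have "if 0 < w ! i then u = z \<bar>w ! i\<bar> \<and> v = z \<bar>w ! i\<bar> else u + v = 2 * z \<bar>w ! i\<bar>"
    proof (cases "0 < w ! i")
      case False
      then have "v = 2 * z \<bar>w ! i\<bar> - u" using u(2) by simp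
      then show ?thesis using False by simp
    qed (use u(2) in auto)
    ultimately show ?thesis by (simp only: Let_def)
  qed
  then show ?thesis unfolding arc_coloring_def by blast
qed

text \<open>
  If colourings that agree on the arcs in \<open>J\<close> are equal, there are at most \<open>3 ^ card J\<close> of them.
\<close>

lemma num_colorings_le_power:
  assumes J: "J \<subseteq> {..<length w}" and w: "w \<noteq> []" and pos: "abs ` set w \<subseteq> set w" "0 \<notin> set w"
    and det: "\<And>z \<xi> z' \<xi>' i. arc_coloring w z \<xi> \<Longrightarrow> arc_coloring w z' \<xi>' \<Longrightarrow>
      (\<And>j. j \<in> J \<Longrightarrow> \<xi> j = \<xi>' j) \<Longrightarrow> i < length w \<Longrightarrow> \<xi> i = \<xi>' i"
  shows "num_colorings w \<le> 3 ^ card J"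
proof -
  let ?r = "\<lambda>(x, z). restrict (\<lambda>i. run_color z x (take i w)) J"
  have fin: "finite J" using J finite_subset by blast
  have "card (J \<rightarrow>\<^sub>E (UNIV :: color set)) = CARD(color) ^ card J"
    using fin by (simp add: card_PiE)
  then have card: "card (J \<rightarrow>\<^sub>E (UNIV :: color set)) = 3 ^ card J" by simp
  have "card (colorings w) \<le> card (J \<rightarrow>\<^sub>E (UNIV :: color set))"
  proof (rule card_inj_on_le[where f = ?r])
    show "finite (J \<rightarrow>\<^sub>E (UNIV :: color set))" using fin by (rule finite_PiE) (rule finite)
    show "?r ` colorings w \<subseteq> J \<rightarrow>\<^sub>E UNIV" by auto
    show "inj_on ?r (colorings w)"
    proof (rule inj_onI)
      fix s t assume "s \<in> colorings w" "t \<in> colorings w" "?r s = ?r t"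
      then obtain x z x' z' where st: "s = (x, z)" "t = (x', z')"
        and c: "colored z x w x" "colored z' x' w x'"
        and sup: "\<And>k. k \<notin> abs ` set w \<Longrightarrow> z k = 0" "\<And>k. k \<notin> abs ` set w \<Longrightarrow> z' k = 0"
        and eq: "restrict (\<lambda>i. run_color z x (take i w)) J = restrict (\<lambda>i. run_color z' x' (take i w)) J"
        unfolding colorings_def by auto
      note a = arc_coloring_run_color[OF c(1)] and a' = arc_coloring_run_color[OF c(2)]
      have "run_color z x (take j w) = run_color z' x' (take j w)" if "j \<in> J" for j
        using fun_cong[OF eq, of j] that by simp
      then have all: "run_color z x (take i w) = run_color z' x' (take i w)" if "i < length w" for i
        using det[OF a a' _ that] by blast
      from all[of 0] w have "x = x'" by simp
      moreover have "z k = z' k" for k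
      proof (cases "k \<in> abs ` set w")
        case True
        then have "k \<in> set w" "0 < k" using pos by (auto simp: less_le)
        then obtain i where i: "i < length w" "w ! i = k" by (auto simp: in_set_conv_nth)
        have "run_color z x (take i w) = z k" "run_color z' x' (take i w) = z' k"
          using a a' i \<open>0 < k\<close> unfolding arc_coloring_def Let_def by auto
        then show ?thesis using all[OF i(1)] by simp
      next
        case False
        then show ?thesis using sup by simp
      qed
      ultimately show "s = t" unfolding st by auto
    qed
  qed
  then show ?thesis unfolding num_colorings_def card .
qed

text \<open>
  Overbridges, each represented by the undercrossing at which it starts.
\<close>

definition bridges :: "int list \<Rightarrow> nat set" where
  "bridges w = {i. i < length w \<and> w ! i < 0 \<and> 0 < w ! (Suc i mod length w)}"

lemma num_colorings_le_bridges:
  assumes w: "w \<noteq> []" and neg: "\<And>a. a \<in> set w \<Longrightarrow> - a \<in> set w" and nz: "0 \<notin> set w"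
  shows "num_colorings w \<le> 3 ^ card (bridges w)"
proof -
  let ?N = "length w"
  let ?J = "(\<lambda>i. Suc i mod ?N) ` bridges w"
  define g where "g t = w ! (t mod ?N)" for t
  have N: "0 < ?N" using w by simp
  have g_in: "g t \<in> set w" for t unfolding g_def using N by simp
  then have g0: "g t \<noteq> 0" for t using nz by metis
  obtain n0 where n0: "g n0 < 0"
  proof -
    from w obtain a where "a \<in> set w" by (cases w) auto
    with neg[of a] nz have "\<exists>b \<in> set w. b < 0" by (metis linorder_neqE_linordered_idom neg_less_0_iff_less)
    then obtain i where "i < ?N" "w ! i < 0" by (metis in_set_conv_nth)
    then have "g i < 0" unfolding g_def by simp
    then show ?thesis by (rule that)
  qed
  have reach: "\<exists>d. i = (n + d) mod ?N" if "i < ?N" for i n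
  proof -
    have "(n + (i + (?N - n mod ?N))) mod ?N = (n mod ?N + (i + (?N - n mod ?N))) mod ?N"
      by (simp add: mod_add_left_eq)
    also have "n mod ?N + (i + (?N - n mod ?N)) = i + ?N"
      using mod_less_divisor[OF N, of n] by linarith
    also have "(i + ?N) mod ?N = i" using that by simp
    finally show ?thesis by metis
  qed
  have "num_colorings w \<le> 3 ^ card ?J"
  proof (rule num_colorings_le_power)
    show "?J \<subseteq> {..<?N}" using N by auto
    show "w \<noteq> []" "0 \<notin> set w" by fact+
    show "abs ` set w \<subseteq> set w" using neg by (auto simp: abs_if)
  next
    fix z \<xi> z' \<xi>' i
    assume ac: "arc_coloring w z \<xi>" "arc_coloring w z' \<xi>'"
      and J: "\<And>j. j \<in> ?J \<Longrightarrow> \<xi> j = \<xi>' j" and i: "i < ?N"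
    have step: "if 0 < g t then \<xi> (t mod ?N) = z \<bar>g t\<bar> \<and> \<xi> (Suc t mod ?N) = z \<bar>g t\<bar>
        else \<xi> (t mod ?N) + \<xi> (Suc t mod ?N) = 2 * z \<bar>g t\<bar>"
      if "arc_coloring w z \<xi>" for t z \<xi>
      using that N unfolding arc_coloring_def g_def Let_def by (metis mod_Suc_eq mod_less_divisor)
    note s = step[OF ac(1)] and s' = step[OF ac(2)]
    \<comment> \<open>Agreement spreads from the first arc of each overbridge to all overpasses, and then to all arcs.\<close>
    have start: "\<xi> (Suc t mod ?N) = \<xi>' (Suc t mod ?N)" if "g t < 0" "0 < g (Suc t)" for t
    proof (rule J)
      have "t mod ?N \<in> bridges w"
        using that N unfolding bridges_def g_def by (simp add: mod_Suc_eq)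
      then show "Suc t mod ?N \<in> ?J" by (rule rev_image_eqI) (simp add: mod_Suc_eq)
    qed
    have over: "0 < g (Suc (n0 + d)) \<Longrightarrow> \<xi> (Suc (n0 + d) mod ?N) = \<xi>' (Suc (n0 + d) mod ?N)" for d
    proof (induction d)
      case 0
      then show ?case using start n0 by simp
    next
      case (Suc d)
      show ?case
      proof (cases "0 < g (Suc (n0 + d))")
        case True
        then show ?thesis using Suc.IH s[of "Suc (n0 + d)"] s'[of "Suc (n0 + d)"] by simp
      next
        case False
        then have "g (Suc (n0 + d)) < 0" using g0[of "Suc (n0 + d)"] by linarith
        then show ?thesis using start Suc.prems by simp
      qed
    qed
    have over': "z (w ! j) = z' (w ! j) \<and> \<xi> j = \<xi>' j" if j: "j < ?N" "0 < w ! j" for j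
    proof -
      obtain d where d: "j = (Suc n0 + d) mod ?N" using reach[OF j(1)] by blast
      then have g: "g (Suc (n0 + d)) = w ! j" unfolding g_def by simp
      then show ?thesis using over[of d] s[of "Suc (n0 + d)"] s'[of "Suc (n0 + d)"] j d by simp
    qed
    have zz: "z \<bar>g t\<bar> = z' \<bar>g t\<bar>" for t
    proof -
      have "\<bar>g t\<bar> \<in> set w" using g_in[of t] neg by (auto simp: abs_if)
      then obtain j where j: "j < ?N" "w ! j = \<bar>g t\<bar>" by (auto simp: in_set_conv_nth)
      then show ?thesis using over'[of j] g0[of t] by simp
    qed
    have "\<exists>p < ?N. 0 < w ! p"
    proof -
      have "- g n0 \<in> set w" using g_in neg by blast
      then show ?thesis using n0 by (metis in_set_conv_nth neg_0_less_iff_less)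
    qed
    then obtain p where p: "p < ?N" "0 < w ! p" by blast
    have "\<xi> ((p + d) mod ?N) = \<xi>' ((p + d) mod ?N)" for d
    proof (induction d)
      case 0
      then show ?case using over'[OF p] p by simp
    next
      case (Suc d)
      show ?case
        using s[of "p + d"] s'[of "p + d"] zz[of "p + d"] Suc
        by (cases "0 < g (p + d)") (auto, metis add_left_cancel)
    qed
    then show "\<xi> i = \<xi>' i" using reach[OF i, of p] by metis
  qed
  also have "card ?J \<le> card (bridges w)"
    by (rule card_image_le) (simp add: bridges_def)
  then have "(3::nat) ^ card ?J \<le> 3 ^ card (bridges w)" by (rule power_increasing) simp
  finally show ?thesis .
qed

text \<open>
  On an interval without interior local maximum a continuous function stays below its value at one
  of the ends.
\<close>

lemma below_endpoints:
  fixes h :: "real \<Rightarrow> real"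
  assumes cont: "\<And>t. isCont h t" and t: "l < t" "t < r"
    and no_max: "\<And>t. l < t \<Longrightarrow> t < r \<Longrightarrow> \<not> (\<forall>\<^sub>F s in at t. h s \<le> h t)"
  shows "h t < max (h l) (h r)"
proof -
  have "continuous_on {l..r} h" using cont by (simp add: continuous_at_imp_continuous_on)
  then obtain u where u: "u \<in> {l..r}" "\<And>s. s \<in> {l..r} \<Longrightarrow> h s \<le> h u"
    using continuous_attains_sup[of "{l..r}" h] t by auto
  have inner: "\<not> (\<forall>s \<in> {l..r}. h s \<le> h v)" if v: "l < v" "v < r" for v
  proof
    assume m: "\<forall>s \<in> {l..r}. h s \<le> h v"
    have "\<forall>\<^sub>F s in nhds v. s \<in> {l<..<r}"
      by (rule eventually_nhds_in_open) (use v in auto)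
    then have "\<forall>\<^sub>F s in at v. h s \<le> h v"
      unfolding eventually_at_filter by (rule eventually_mono) (use m in auto)
    then show False using no_max[OF v] by blast
  qed
  have "u = l \<or> u = r" using inner[of u] u by force
  moreover have "h t < h u" using inner[OF t] u(2) t by (meson atLeastAtMost_iff leI less_imp_le order_trans)
  ultimately show ?thesis by auto
qed

text \<open>
  At a crossing, if two colourings agree on one of the two arcs of each strand, they agree on all
  four arcs.
\<close>

lemma arc_coloring_crossing:
  assumes ac: "arc_coloring w z \<xi>" "arc_coloring w z' \<xi>'"
    and ij: "i < length w" "j < length w" "w ! j = - w ! i" and nz: "w ! i \<noteq> 0"
    and eqi: "\<xi> i = \<xi>' i \<or> \<xi> (Suc i mod length w) = \<xi>' (Suc i mod length w)"
    and eqj: "\<xi> j = \<xi>' j \<or> \<xi> (Suc j mod length w) = \<xi>' (Suc j mod length w)"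
  shows "\<xi> i = \<xi>' i \<and> \<xi> (Suc i mod length w) = \<xi>' (Suc i mod length w)"
proof -
  let ?n = "\<lambda>i. Suc i mod length w"
  have c: "if 0 < w ! i then \<xi> i = z \<bar>w ! i\<bar> \<and> \<xi> (?n i) = z \<bar>w ! i\<bar> else \<xi> i + \<xi> (?n i) = 2 * z \<bar>w ! i\<bar>"
    if "arc_coloring w z \<xi>" "i < length w" for i z \<xi>
    using that unfolding arc_coloring_def Let_def by blast
  note c1 = c[OF ac(1) ij(1)] c[OF ac(1) ij(2)] c[OF ac(2) ij(1)] c[OF ac(2) ij(2)]
  have abs: "\<bar>w ! j\<bar> = \<bar>w ! i\<bar>" using ij(3) by simp
  show ?thesis
  proof (cases "0 < w ! i")
    case True
    then show ?thesis using c1(1,3) eqi by auto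
  next
    case False
    then have "0 < w ! j" using ij(3) nz by simp
    then have "z \<bar>w ! i\<bar> = z' \<bar>w ! i\<bar>" using c1(2,4) eqj unfolding abs by auto
    then have sum: "\<xi> i + \<xi> (?n i) = \<xi>' i + \<xi>' (?n i)" using False c1(1,3) by simp
    show ?thesis using eqi
    proof
      assume "\<xi> i = \<xi>' i"
      with sum show ?thesis by simp
    next
      assume "\<xi> (?n i) = \<xi>' (?n i)"
      with sum show ?thesis by simp
    qed
  qed
qed

text \<open>
  Here \<open>h\<close> is the height along the closed curve, \<open>ts\<close> lists the parameters of the passages of
  crossings, and the two passages of a crossing have equal height.
\<close>

lemma num_colorings_le_maxima:
  fixes h :: "real \<Rightarrow> real" and ts :: "real list"
  assumes cont: "\<And>t. isCont h t" and per: "\<And>t. h (t + 1) = h t"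
    and fin: "finite {t \<in> {0..<1}. \<forall>\<^sub>F s in at t. h s \<le> h t}"
    and ts: "sorted_wrt (<) ts" "set ts \<subseteq> {0..<1}" "length ts = length w" and w: "w \<noteq> []"
    and no_max: "\<And>t. t \<in> set ts \<Longrightarrow> \<not> (\<forall>\<^sub>F s in at t. h s \<le> h t)"
    and partner: "\<And>i. i < length w \<Longrightarrow> \<exists>j < length w. w ! j = - w ! i \<and> h (ts ! j) = h (ts ! i)"
    and nz: "0 \<notin> set w"
  shows "num_colorings w \<le> 3 ^ card {t \<in> {0..<1}. \<forall>\<^sub>F s in at t. h s \<le> h t}"
proof -
  let ?N = "length w" and ?L = "{t \<in> {0..<1}. \<forall>\<^sub>F s in at t. h s \<le> h t}"
  have N: "0 < ?N" using w by simp
  \<comment> \<open>Arc \<open>j\<close> is the parameter interval from \<open>l j\<close> to \<open>r j\<close>; arc \<open>0\<close> crosses the base point.\<close>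
  define l where "l j = (if j = 0 then ts ! (?N - 1) - 1 else ts ! (j - 1))" for j
  define r where "r j = ts ! j" for j
  \<comment> \<open>\<open>J\<close> is the set of arcs that contain a local maximum, and \<open>arc\<close> maps a parameter to its arc.\<close>
  define J where "J = {j. j < ?N \<and> (\<exists>t. l j < t \<and> t < r j \<and> (\<forall>\<^sub>F s in at t. h s \<le> h t))}"
  define arc where "arc t = card {i. i < ?N \<and> ts ! i < t} mod ?N" for t
  have less: "ts ! i < ts ! j" if "i < j" "j < ?N" for i j
    using sorted_wrt_nth_less[OF ts(1) that(1)] that(2) ts(3) by simp
  have le: "ts ! i \<le> ts ! j" if "i \<le> j" "j < ?N" for i j
    using less[of i j] that by (cases "i = j") auto
  have range: "0 \<le> ts ! i" "ts ! i < 1" if "i < ?N" for i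
  proof -
    have "ts ! i \<in> {0..<1}" by (rule subsetD[OF ts(2)], rule nth_mem) (use that ts(3) in simp)
    then show "0 \<le> ts ! i" "ts ! i < 1" by auto
  qed
  have shift: "(\<forall>\<^sub>F s in at (t + 1). h s \<le> h (t + 1)) \<longleftrightarrow> (\<forall>\<^sub>F s in at t. h s \<le> h t)" for t
  proof -
    have "filtermap (\<lambda>x. x - (- 1)) (at t) = at (t - (- 1))"
      by (rule filtermap_at_shift)
    then have "at (t + 1) = filtermap (\<lambda>x. x + 1) (at t)" by simp
    then show ?thesis by (simp only: eventually_filtermap per)
  qed
  have "J \<subseteq> arc ` ?L"
  proof
    fix j assume "j \<in> J"
    then obtain t where j: "j < ?N" and t: "l j < t" "t < r j" "\<forall>\<^sub>F s in at t. h s \<le> h t"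
      unfolding J_def by blast
    show "j \<in> arc ` ?L"
    proof (cases "j = 0 \<and> t < 0")
      case True
      have "ts ! i < t + 1" if "i < ?N" for i
      proof -
        have "ts ! i \<le> ts ! (?N - 1)" by (rule le) (use that in linarith)+
        then show ?thesis using True t(1) unfolding l_def by simp
      qed
      then have "{i. i < ?N \<and> ts ! i < t + 1} = {..<?N}" by auto
      then have "j = arc (t + 1)" using True unfolding arc_def by simp
      moreover have "t + 1 \<in> ?L"
        using True t range[of "?N - 1"] N shift[of t] unfolding l_def by auto
      ultimately show ?thesis by blast
    next
      case False
      have t1: "t < 1" using t(2) range(2)[OF j] unfolding r_def by simp
      have up: "i < j" if "i < ?N" "ts ! i < t" for i
        using le[of j i] that t(2) unfolding r_def by force
      have "{i. i < ?N \<and> ts ! i < t} = {..<j}"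
      proof (intro equalityI subsetI)
        fix i assume "i \<in> {i. i < ?N \<and> ts ! i < t}"
        then show "i \<in> {..<j}" using up by simp
      next
        fix i assume i: "i \<in> {..<j}"
        then have "ts ! i \<le> ts ! (j - 1)" "j \<noteq> 0" using le[of i "j - 1"] j by auto
        then have "ts ! i < t" using t(1) unfolding l_def by simp
        then show "i \<in> {i. i < ?N \<and> ts ! i < t}" using i j by simp
      qed
      then have arc: "j = arc t" using j unfolding arc_def by simp
      have "0 \<le> t"
      proof (cases "j = 0")
        case False
        have "0 \<le> ts ! (j - 1)" by (rule range(1)) (use j in linarith)
        then show ?thesis using t(1) False unfolding l_def by simp
      qed (use \<open>\<not> (j = 0 \<and> t < 0)\<close> in simp)
      then have "t \<in> ?L" using t(3) t1 by simp
      with arc show ?thesis by (rule image_eqI)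
    qed
  qed
  then have card_J: "card J \<le> card ?L" using surj_card_le[OF fin] by blast
  have lr: "h (l j) = h (ts ! ((j + ?N - 1) mod ?N))" "h (r j) = h (ts ! j)" if "j < ?N" for j
  proof -
    have "h (ts ! (?N - 1) - 1) = h (ts ! (?N - 1))" using per[of "ts ! (?N - 1) - 1"] by simp
    moreover have "(j + ?N - 1) mod ?N = j - 1" if "j \<noteq> 0"
    proof -
      have "j + ?N - 1 = (j - 1) + ?N" using that by linarith
      then have "(j + ?N - 1) mod ?N = (j - 1) mod ?N" by (simp only: mod_add_self2)
      also have "(j - 1) mod ?N = j - 1" by (rule mod_less) (use \<open>j < ?N\<close> in linarith)
      finally show ?thesis .
    qed
    ultimately show "h (l j) = h (ts ! ((j + ?N - 1) mod ?N))" unfolding l_def using N by auto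
    show "h (r j) = h (ts ! j)" unfolding r_def ..
  qed
  have "num_colorings w \<le> 3 ^ card J"
  proof (rule num_colorings_le_power)
    show "J \<subseteq> {..<?N}" unfolding J_def by auto
    show "w \<noteq> []" "0 \<notin> set w" by fact+
    have "- a \<in> set w" if "a \<in> set w" for a
      using that partner by (metis in_set_conv_nth)
    then show "abs ` set w \<subseteq> set w" by (auto simp: abs_if)
  next
    fix z \<xi> z' \<xi>' i0
    assume ac: "arc_coloring w z \<xi>" "arc_coloring w z' \<xi>'"
      and J: "\<And>j. j \<in> J \<Longrightarrow> \<xi> j = \<xi>' j" and i0: "i0 < ?N"
    \<comment> \<open>\<open>D\<close> is the set of arcs with different colours, and \<open>H j\<close> is the height of the higher end of arc \<open>j\<close>.\<close>
    define D where "D = {j. j < ?N \<and> \<xi> j \<noteq> \<xi>' j}"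
    define H where "H j = max (h (l j)) (h (r j))" for j
    have "D = {}"
    proof (rule ccontr)
      assume "D \<noteq> {}"
      moreover have finD: "finite D" unfolding D_def by simp
      ultimately have "Max (H ` D) \<in> H ` D" by (intro Max_in) auto
      then obtain j where j: "j \<in> D" "H j = Max (H ` D)" by auto
      have max: "H k \<le> H j" if "k \<in> D" for k
        unfolding j(2) using finD that by (intro Max_ge) auto
      have below: "h t < H j" if "k \<in> D" "l k < t" "t < r k" for k t
      proof -
        have "k \<notin> J" "k < ?N" using that J unfolding D_def by auto
        then have "\<not> (\<forall>\<^sub>F s in at t. h s \<le> h t)" if "l k < t" "t < r k" for t
          using that unfolding J_def by blast
        then have "h t < H k"
          unfolding H_def using below_endpoints[OF cont that(2,3)] by blast
        then show ?thesis using max[OF that(1)] by linarith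
      qed
      \<comment> \<open>If the arcs on both sides of \<open>ts ! k\<close> were in \<open>D\<close>, there would be a local maximum at a crossing.\<close>
      have not_both: "\<xi> k = \<xi>' k \<or> \<xi> (Suc k mod ?N) = \<xi>' (Suc k mod ?N)"
        if k: "k < ?N" "h (ts ! k) = H j" for k
      proof (rule ccontr)
        assume "\<not> ?thesis"
        then have D: "k \<in> D" "Suc k mod ?N \<in> D" using k N unfolding D_def by auto
        have lk: "l k < ts ! k"
          using less[of "k - 1" k] range[of "?N - 1"] range(1)[of 0] k(1) N unfolding l_def by auto
        have left: "h s < h (ts ! k)" if "l k < s" "s < ts ! k" for s
          using below[OF D(1), of s] that k(2) unfolding r_def by simp
        obtain e where e: "ts ! k < e" "\<And>s. ts ! k < s \<Longrightarrow> s < e \<Longrightarrow> h s < h (ts ! k)"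
        proof (cases "Suc k = ?N")
          case True
          show ?thesis
          proof (rule that)
            show "ts ! k < ts ! 0 + 1" using range[of k] range[of 0] k(1) N by simp
            fix s assume s: "ts ! k < s" "s < ts ! 0 + 1"
            have "?N - 1 = k" using True by simp
            then have "h (s - 1) < H j"
              using below[of 0 "s - 1"] D(2) True s unfolding l_def r_def by simp
            then show "h s < h (ts ! k)" using per[of "s - 1"] k(2) by simp
          qed
        next
          case False
          then have k': "Suc k < ?N" using k(1) by simp
          show ?thesis
          proof (rule that)
            show "ts ! k < ts ! Suc k" using less k' by simp
            fix s assume s: "ts ! k < s" "s < ts ! Suc k"
            then show "h s < h (ts ! k)"
              using below[OF D(2), of s] k' k(2) unfolding l_def r_def by simp
          qed
        qed
        have "\<forall>\<^sub>F s in nhds (ts ! k). s \<in> {l k<..<e}"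
          by (rule eventually_nhds_in_open) (use lk e in auto)
        then have "\<forall>\<^sub>F s in at (ts ! k). h s \<le> h (ts ! k)"
          unfolding eventually_at_filter
        proof (rule eventually_mono, intro impI)
          fix s assume "s \<in> {l k<..<e}" "s \<noteq> ts ! k"
          then show "h s \<le> h (ts ! k)" using left[of s] e(2)[of s] by force
        qed
        then show False using no_max[of "ts ! k"] k(1) ts(3) by simp
      qed
      have jN: "j < ?N" using j unfolding D_def by simp
      have "\<exists>i < ?N. (i = j \<or> Suc i mod ?N = j) \<and> h (ts ! i) = H j"
      proof (cases "h (l j) \<le> h (r j)")
        case True
        then show ?thesis using lr(2)[OF jN] jN unfolding H_def by auto
      next
        case False
        have "Suc ((j + ?N - 1) mod ?N) mod ?N = Suc (j + ?N - 1) mod ?N" by (simp add: mod_Suc_eq)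
        also have "Suc (j + ?N - 1) = j + ?N" using N by simp
        finally have "Suc ((j + ?N - 1) mod ?N) mod ?N = j" using jN by simp
        then show ?thesis using False lr(1)[OF jN] N unfolding H_def
          by (intro exI[of _ "(j + ?N - 1) mod ?N"]) auto
      qed
      then obtain i where i: "i < ?N" "i = j \<or> Suc i mod ?N = j" "h (ts ! i) = H j" by blast
      obtain i' where i': "i' < ?N" "w ! i' = - w ! i" "h (ts ! i') = h (ts ! i)"
        using partner[OF i(1)] by blast
      have "w ! i \<noteq> 0" using nz i(1) nth_mem by metis
      then have "\<xi> i = \<xi>' i \<and> \<xi> (Suc i mod ?N) = \<xi>' (Suc i mod ?N)"
        using arc_coloring_crossing[OF ac i(1) i'(1,2)] not_both[OF i(1,3)] not_both[of i'] i' i(3) by simp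
      then show False using i(2) j(1) unfolding D_def by auto
    qed
    then show "\<xi> i0 = \<xi>' i0" using i0 unfolding D_def by blast
  qed
  also have "(3::nat) ^ card J \<le> 3 ^ card ?L" using card_J by (rule power_increasing) simp
  finally show ?thesis .
qed

section \<open>Colourings and the two bridge numbers\<close>

lemma num_colorings_Nil: "num_colorings [] \<le> 3"
proof -
  have "card (colorings []) \<le> card (UNIV :: color set)"
    by (rule card_inj_on_le[where f = fst]) (auto simp: colorings_def inj_on_def)
  then show ?thesis by (simp add: num_colorings_def)
qed

text \<open>
  A strand contains an overpass if and only if the entry after its initial underpass is one.
\<close>

lemma overbridges_eq:
  assumes "c \<noteq> []"
  shows "overbridges c = card (bridges (map fst c))"
proof -
  let ?N = "length c"
  have "(\<exists>(a, e) \<in> set (strand c i). 0 < a) \<longleftrightarrow> 0 < fst (c ! (Suc i mod ?N))"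
    if i: "i < ?N" "fst (c ! i) < 0" for i
  proof -
    have "rotate i c \<noteq> []" using assms by simp
    then obtain x xs where r: "rotate i c = x # xs" by (cases "rotate i c") auto
    have x: "x = c ! i" using hd_rotate_conv_nth[OF assms, of i] r i by simp
    have later: "rotate (Suc i) c = xs @ [x]" using r by simp
    obtain y ys where y: "xs @ [x] = y # ys" by (cases "xs @ [x]") auto
    have "y = c ! (Suc i mod ?N)" using hd_rotate_conv_nth[OF assms, of "Suc i"] later y by simp
    moreover have "strand c i = x # takeWhile (\<lambda>(a, e). 0 < a) (y # ys)
        @ [hd (dropWhile (\<lambda>(a, e). 0 < a) (y # ys))]"
      unfolding strand_def Let_def r by (simp add: y)
    ultimately show ?thesis using x i(2) by (cases x; cases y) auto
  qed
  then have "{i. i < ?N \<and> fst (c ! i) < 0 \<and> (\<exists>(a, e) \<in> set (strand c i). 0 < a)} = bridges (map fst c)"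
    unfolding bridges_def using assms by (auto simp: nth_map)
  then show ?thesis unfolding overbridges_def by simp
qed

lemma index_colorings_0:
  assumes "gauss_code c"
  shows "index_colorings 0 c = num_colorings (map fst c)"
proof -
  have "potential 0 (\<lambda>_. 0) 0 c" by (induction c) auto
  moreover have "switch_entry 0 (\<lambda>_. 0) = fst" unfolding switch_entry_def by auto
  ultimately show ?thesis using index_colorings_eq[OF assms] by metis
qed

lemma index_colorings_le_overbridges:
  assumes g: "gauss_code c" and c: "c \<noteq> []"
  shows "index_colorings 0 c \<le> 3 ^ overbridges c"
  unfolding index_colorings_0[OF g] overbridges_eq[OF c]
  by (rule num_colorings_le_bridges) (use g c gauss_code_facts(2,3) in force)+

lemma index_colorings_le_local_maxima:
  assumes d: "virtual_diagram \<gamma> X" "height_generic \<gamma>" "diagram_code \<gamma> X c"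
    and g: "gauss_code c" and c: "c \<noteq> []"
  shows "index_colorings \<omega> c \<le> 3 ^ card (local_maxima \<gamma>)"
proof -
  let ?ts = "sorted_list_of_set (fst ` X \<union> snd ` X)"
  have imm: "generic_immersion \<gamma>" and X: "X \<subseteq> double_points \<gamma>"
    using d(1) unfolding virtual_diagram_def by auto
  have fin: "finite (fst ` X \<union> snd ` X)"
    using imm X finite_subset unfolding generic_immersion_def by blast
  have lm: "local_maxima \<gamma> = {t \<in> {0..<1}. \<forall>\<^sub>F s in at t. height \<gamma> s \<le> height \<gamma> t}"
    unfolding local_maxima_def ..
  obtain l :: "real \<times> real \<Rightarrow> nat" where l: "bij_betw l X {1..card X}" and len: "length c = length ?ts"
    and entry: "\<And>i. i < length c \<Longrightarrow> \<exists>x \<in> X.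
       (?ts ! i = fst x \<and> c ! i = (int (l x), crossing_sign \<gamma> x)) \<or>
       (?ts ! i = snd x \<and> c ! i = (- int (l x), crossing_sign \<gamma> x))"
    using d(3) unfolding diagram_code_def Let_def by blast
  obtain P where P: "potential \<omega> P 0 c" using gauss_potential[OF g] by blast
  have dp: "fst x \<in> {0..<1}" "snd x \<in> {0..<1}" "\<gamma> (fst x) = \<gamma> (snd x)"
    "fst x \<in> fst ` double_points \<gamma>" "snd x \<in> fst ` double_points \<gamma>" if "x \<in> X" for x
  proof -
    have x: "(fst x, snd x) \<in> double_points \<gamma>" using that X by auto
    then have "(snd x, fst x) \<in> double_points \<gamma>" unfolding double_points_def by auto
    then show "snd x \<in> fst ` double_points \<gamma>" by force
    show "fst x \<in> fst ` double_points \<gamma>" using x by force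
    show "fst x \<in> {0..<1}" "snd x \<in> {0..<1}" "\<gamma> (fst x) = \<gamma> (snd x)"
      using x unfolding double_points_def by auto
  qed
  show ?thesis
    unfolding index_colorings_eq[OF g P] lm
  proof (rule num_colorings_le_maxima)
    show "isCont (height \<gamma>) t" for t
    proof -
      have "((\<lambda>f t. vector_derivative f (at t)) ^^ 0) \<gamma> differentiable (at t)"
        using imm unfolding generic_immersion_def smooth_def by blast
      then have "isCont \<gamma> t" by (simp add: differentiable_imp_continuous_within)
      then show ?thesis unfolding height_def by (rule isCont_Im)
    qed
    show "height \<gamma> (t + 1) = height \<gamma> t" for t
      using imm unfolding generic_immersion_def height_def by simp
    show "finite {t \<in> {0..<1}. \<forall>\<^sub>F s in at t. height \<gamma> s \<le> height \<gamma> t}"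
      using d(2) unfolding height_generic_def lm by blast
    show "sorted_wrt (<) ?ts" by (rule strict_sorted_list_of_set)
    show "set ?ts \<subseteq> {0..<1}" using fin dp by auto
    show "length ?ts = length (map (switch_entry \<omega> P) c)" using len by simp
    show "map (switch_entry \<omega> P) c \<noteq> []" using c by simp
    show "\<not> (\<forall>\<^sub>F s in at t. height \<gamma> s \<le> height \<gamma> t)" if "t \<in> set ?ts" for t
    proof
      assume "\<forall>\<^sub>F s in at t. height \<gamma> s \<le> height \<gamma> t"
      moreover have "t \<in> {0..<1}" "t \<in> fst ` double_points \<gamma>" using that fin dp by auto
      ultimately show False using d(2) unfolding height_generic_def local_maxima_def by blast
    qed
    show "0 \<notin> set (map (switch_entry \<omega> P) c)"
    proof
      assume "0 \<in> set (map (switch_entry \<omega> P) c)"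
      then obtain x where "x \<in> set c" "switch_entry \<omega> P x = 0" by auto
      then have "fst x = 0" using switch_entry_cases[of \<omega> P x] by auto
      then show False using gauss_code_facts(3)[OF g] \<open>x \<in> set c\<close> by force
    qed
    fix i assume "i < length (map (switch_entry \<omega> P) c)"
    then have i: "i < length c" by simp
    obtain a e where ae: "c ! i = (a, e)" by (cases "c ! i")
    then have "(- a, e) \<in> set c" using gauss_code_facts(4)[OF g] i by (metis nth_mem)
    then obtain j where j: "j < length c" "c ! j = (- a, e)" by (auto simp: in_set_conv_nth)
    obtain x y where x: "x \<in> X" "(?ts ! i = fst x \<and> a = int (l x)) \<or> (?ts ! i = snd x \<and> a = - int (l x))"
      and y: "y \<in> X" "(?ts ! j = fst y \<and> - a = int (l y)) \<or> (?ts ! j = snd y \<and> - a = - int (l y))"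
      using entry[OF i] entry[OF j(1)] unfolding ae j(2) by auto
    have pos: "0 < l x" "0 < l y" using x(1) y(1) bij_betwE[OF l] by force+
    have "l x = l y" using x(2) y(2) pos by auto
    then have "x = y" using l x(1) y(1) unfolding bij_betw_def inj_on_def by blast
    then have "\<gamma> (?ts ! j) = \<gamma> (?ts ! i)" using x(2) y(2) pos dp(3)[OF x(1)] by auto
    then show "\<exists>j < length (map (switch_entry \<omega> P) c). map (switch_entry \<omega> P) c ! j = - map (switch_entry \<omega> P) c ! i
        \<and> height \<gamma> (?ts ! j) = height \<gamma> (?ts ! i)"
      using i j ae by (intro exI[of _ j]) (simp add: switch_entry_neg height_def)
  qed
qed

section \<open>The family of codes\<close>

text \<open>
  Nested gadgets with the labels above \<open>b\<close>.  The signs give the first and fourth crossing of each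
  gadget index \<open>-1\<close> and the other two index \<open>1\<close>, independently of what surrounds the gadget or is
  nested in it.
\<close>

primrec gadgets :: "int \<Rightarrow> nat \<Rightarrow> code" where
  "gadgets b 0 = []"
| "gadgets b (Suc n) = [(b + 1, 1), (b + 2, 1), (b + 3, -1), (b + 4, -1)] @ gadgets (b + 4) n @
     [(- (b + 3), -1), (- (b + 4), -1), (- (b + 1), 1), (- (b + 2), 1)]"

text \<open>
  The underpass block \<open>i\<close>, which leads from bridge \<open>i\<close> to bridge \<open>i + 1\<close> (modulo \<open>m\<close>), followed by
  the overpasses of bridge \<open>i + 1\<close>.  The block runs under bridge \<open>i + 1\<close> at crossing \<open>2 i + 1\<close> and then
  under bridge \<open>i\<close> at crossing \<open>2 i + 2\<close>.  The second reflection compensates the first in characteristic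
  three, so that the colour of bridge \<open>i\<close> becomes that of bridge \<open>i + 1\<close>.
\<close>

definition bridge_block :: "nat \<Rightarrow> nat \<Rightarrow> code" where
  "bridge_block m i = [(- int (2 * i + 1), 1), (- int (2 * i + 2), 1), (int (2 * i + 1), 1),
     (int (2 * (Suc i mod m) + 2), 1)]"

definition bridge_chain :: "nat \<Rightarrow> nat \<Rightarrow> code" where
  "bridge_chain m q = concat (map (bridge_block m) [0..<q])"

text \<open>
  The overpasses of the gadgets prolong bridge \<open>0\<close>, and their underpasses precede block \<open>0\<close>.
\<close>

definition family_code :: "nat \<Rightarrow> nat \<Rightarrow> code" where
  "family_code m n = gadgets (int (2 * m)) n @ bridge_chain m m"

lemma chain_Suc: "bridge_chain m (Suc q) = bridge_chain m q @ bridge_block m q"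
  by (simp add: bridge_chain_def)

lemma length_gadgets [simp]: "length (gadgets b n) = 8 * n"
  by (induction n arbitrary: b) auto

lemma length_chain [simp]: "length (bridge_chain m q) = 4 * q"
  by (induction q) (simp add: bridge_chain_def, simp add: chain_Suc bridge_block_def)

lemma fst_gadgets:
  assumes "0 \<le> b"
  shows "fst ` set (gadgets b n) = {a. b < \<bar>a\<bar> \<and> \<bar>a\<bar> \<le> b + 4 * int n}"
  using assms
proof (induction n arbitrary: b)
  case (Suc n)
  have "fst ` set (gadgets b (Suc n)) =
      {b + 1, b + 2, b + 3, b + 4, - (b + 3), - (b + 4), - (b + 1), - (b + 2)} \<union> fst ` set (gadgets (b + 4) n)"
    by auto
  also have "\<dots> = {a. b < \<bar>a\<bar> \<and> \<bar>a\<bar> \<le> b + 4 * int (Suc n)}"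
    unfolding Suc.IH[of "b + 4", OF order_trans[OF Suc.prems, of "b + 4", simplified]] using Suc.prems by auto
  finally show ?case .
qed auto

lemma neg_gadgets: "(a, e) \<in> set (gadgets b n) \<Longrightarrow> (- a, e) \<in> set (gadgets b n)"
proof (induction n arbitrary: b)
  case (Suc n)
  let ?S = "{(b + 1, 1), (b + 2, 1), (b + 3, -1), (b + 4, -1), (- (b + 3), -1), (- (b + 4), -1),
    (- (b + 1), 1), (- (b + 2), 1)} :: (int \<times> int) set"
  have S: "set (gadgets b (Suc n)) = ?S \<union> set (gadgets (b + 4) n)" by auto
  have "(- a, e) \<in> ?S" if "(a, e) \<in> ?S"
    using that
    by (elim insertE emptyE Pair_inject; hypsubst; simp only: insert_iff prod.inject minus_minus simp_thms)
  moreover have "(- a, e) \<in> set (gadgets (b + 4) n)" if "(a, e) \<in> set (gadgets (b + 4) n)"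
    using Suc.IH[OF that] .
  moreover have "(a, e) \<in> ?S \<or> (a, e) \<in> set (gadgets (b + 4) n)"
    using Suc.prems unfolding S by (rule UnE) simp_all
  ultimately show ?case unfolding S by (simp only: Un_iff) metis
qed simp

lemma snd_gadgets: "snd ` set (gadgets b n) \<subseteq> {1, -1}"
  by (induction n arbitrary: b) auto

lemma snd_chain: "x \<in> set (bridge_chain m q) \<Longrightarrow> snd x = 1"
  by (auto simp: bridge_chain_def bridge_block_def)

lemma fst_chain:
  assumes m: "1 \<le> m"
  shows "fst ` set (bridge_chain m m) = {a. 1 \<le> \<bar>a\<bar> \<and> \<bar>a\<bar> \<le> int (2 * m)}"
proof (intro equalityI subsetI)
  fix a assume "a \<in> fst ` set (bridge_chain m m)"
  then obtain i where "i < m" "a \<in> {- int (2 * i + 1), - int (2 * i + 2), int (2 * i + 1), int (2 * (Suc i mod m) + 2)}"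
    unfolding bridge_chain_def bridge_block_def by auto
  moreover have "Suc i mod m < m" using m by simp
  ultimately obtain i j where "i < m" "j < m"
    "a \<in> {- int (2 * i + 1), - int (2 * i + 2), int (2 * i + 1), int (2 * j + 2)}" by blast
  then show "a \<in> {a. 1 \<le> \<bar>a\<bar> \<and> \<bar>a\<bar> \<le> int (2 * m)}" by auto
next
  fix a assume a: "a \<in> {a. 1 \<le> \<bar>a\<bar> \<and> \<bar>a\<bar> \<le> int (2 * m)}"
  have *: "x \<in> fst ` set (bridge_chain m m)" if "x \<in> fst ` set (bridge_block m i)" "i < m" for x i
    using that unfolding bridge_chain_def by force
  show "a \<in> fst ` set (bridge_chain m m)"
  proof (cases "odd \<bar>a\<bar>")
    case True
    then obtain k where k: "\<bar>a\<bar> = 2 * k + 1" by (elim oddE)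
    then have "a = int (2 * nat k + 1) \<or> a = - int (2 * nat k + 1)" "nat k < m" using a by auto
    then show ?thesis by (intro *[of _ "nat k"]) (auto simp: bridge_block_def)
  next
    case False
    then have "even \<bar>a\<bar>" by simp
    then obtain k where k: "\<bar>a\<bar> = 2 * k" by (elim evenE)
    define i where "i = nat (k - 1)"
    have i: "a = int (2 * i + 2) \<or> a = - int (2 * i + 2)" "i < m" using a k unfolding i_def by auto
    from i(1) show ?thesis
    proof
      assume "a = - int (2 * i + 2)"
      then show ?thesis by (intro *[OF _ i(2)]) (auto simp: bridge_block_def)
    next
      assume a': "a = int (2 * i + 2)"
      have "Suc ((i + m - 1) mod m) mod m = Suc (i + m - 1) mod m" by (simp add: mod_Suc_eq)
      also have "Suc (i + m - 1) = i + m" using m by simp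
      finally have "Suc ((i + m - 1) mod m) mod m = i" using i(2) by simp
      then show ?thesis using a' m by (intro *[of _ "(i + m - 1) mod m"]) (auto simp: bridge_block_def)
    qed
  qed
qed

lemma abs_labels: "abs ` {a :: int. 1 \<le> \<bar>a\<bar> \<and> \<bar>a\<bar> \<le> k} = {1..k}"
proof (intro equalityI subsetI)
  fix a assume "a \<in> {1..k}"
  then have "a = \<bar>a\<bar>" "a \<in> {a. 1 \<le> \<bar>a\<bar> \<and> \<bar>a\<bar> \<le> k}" by auto
  then show "a \<in> abs ` {a. 1 \<le> \<bar>a\<bar> \<and> \<bar>a\<bar> \<le> k}" by (rule image_eqI)
qed auto

lemma card_labels: "card {a :: int. 1 \<le> \<bar>a\<bar> \<and> \<bar>a\<bar> \<le> int k} = 2 * k"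
proof -
  have "{a :: int. 1 \<le> \<bar>a\<bar> \<and> \<bar>a\<bar> \<le> int k} = {1..int k} \<union> {- int k..-1}" by auto
  then show ?thesis by (simp add: card_Un_disjoint)
qed

lemma fst_family:
  assumes "1 \<le> m"
  shows "fst ` set (family_code m n) = {a. 1 \<le> \<bar>a\<bar> \<and> \<bar>a\<bar> \<le> int (2 * m + 4 * n)}"
proof -
  have "fst ` set (family_code m n) = {a. int (2 * m) < \<bar>a\<bar> \<and> \<bar>a\<bar> \<le> int (2 * m) + 4 * int n} \<union>
      {a. 1 \<le> \<bar>a\<bar> \<and> \<bar>a\<bar> \<le> int (2 * m)}"
    unfolding family_code_def set_append image_Un fst_chain[OF assms] by (subst fst_gadgets) auto
  then show ?thesis using assms by auto
qed

lemma gauss_code_family: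
  assumes m: "1 \<le> m"
  shows "gauss_code (family_code m n)"
proof -
  let ?c = "family_code m n"
  have "length (map fst ?c) = 2 * (2 * m + 4 * n)" unfolding family_code_def by simp
  then have "card (set (map fst ?c)) = length (map fst ?c)"
    unfolding set_map fst_family[OF m] card_labels by simp
  then have dist: "distinct (map fst ?c)" by (rule card_distinct)
  have neg: "(- a, e) \<in> set ?c" if "(a, e) \<in> set ?c" for a e
  proof (cases "(a, e) \<in> set (gadgets (int (2 * m)) n)")
    case True
    then show ?thesis using neg_gadgets unfolding family_code_def by simp
  next
    case False
    then have ch: "(a, e) \<in> set (bridge_chain m m)" using that unfolding family_code_def by simp
    then have "a \<in> fst ` set (bridge_chain m m)" by force
    then have "- a \<in> fst ` set (bridge_chain m m)" unfolding fst_chain[OF m] by simp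
    then obtain f where "(- a, f) \<in> set (bridge_chain m m)" by force
    moreover have "f = e" using snd_chain[OF ch] snd_chain[OF calculation] by simp
    ultimately show ?thesis unfolding family_code_def by simp
  qed
  have uniq: "e = f" if "(a, e) \<in> set ?c" "(a, f) \<in> set ?c" for a e f
    using that dist by (metis eq_key_imp_eq_value)
  have "e = f" if "(a, e) \<in> set ?c" "(b, f) \<in> set ?c" "\<bar>a\<bar> = \<bar>b\<bar>" for a e b f
  proof -
    have "b = a \<or> b = - a" using that(3) by auto
    then show ?thesis using uniq[OF that(1)] uniq[OF neg[OF that(1)]] that(2) by auto
  qed
  moreover have "snd ` set ?c \<subseteq> {1, -1}"
    using snd_gadgets[of "int (2 * m)" n] snd_chain[of _ m m] unfolding family_code_def by auto
  ultimately show ?thesis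
    unfolding gauss_code_def using dist fst_family[OF m, of n] by blast
qed

lemma gadgets_split:
  assumes "0 \<le> b"
  shows "\<exists>u v. gadgets b n = u @ v \<and> length u = 4 * n \<and> length v = 4 * n \<and>
    (\<forall>x \<in> set u. 0 < fst x) \<and> (\<forall>x \<in> set v. fst x < 0)"
  using assms
proof (induction n arbitrary: b)
  case (Suc n)
  then obtain u v where uv: "gadgets (b + 4) n = u @ v" "length u = 4 * n" "length v = 4 * n"
    "\<forall>x \<in> set u. 0 < fst x" "\<forall>x \<in> set v. fst x < 0" by (metis add_nonneg_nonneg zero_le_numeral)
  show ?case
    by (rule exI[of _ "[(b + 1, 1), (b + 2, 1), (b + 3, -1), (b + 4, -1)] @ u"],
        rule exI[of _ "v @ [(- (b + 3), -1), (- (b + 4), -1), (- (b + 1), 1), (- (b + 2), 1)]"])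
      (use uv Suc.prems in auto)
qed simp

lemma nth_chain: "i < q \<Longrightarrow> r < 4 \<Longrightarrow> bridge_chain m q ! (4 * i + r) = bridge_block m i ! r"
proof (induction q)
  case (Suc q)
  then show ?case
    by (cases "i < q") (auto simp: chain_Suc nth_append less_Suc_eq)
qed simp

lemma overbridges_family:
  assumes m: "1 \<le> m"
  shows "overbridges (family_code m n) \<le> m"
proof -
  let ?w = "map fst (family_code m n)"
  obtain u v where uv: "gadgets (int (2 * m)) n = u @ v" "length u = 4 * n" "length v = 4 * n"
    "\<forall>x \<in> set u. 0 < fst x" "\<forall>x \<in> set v. fst x < 0" using gadgets_split[of "int (2 * m)" n] by auto
  have fam: "family_code m n = u @ v @ bridge_chain m m" unfolding family_code_def uv by simp
  have len: "length ?w = 8 * n + 4 * m" unfolding family_code_def by simp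
  have over: "0 < ?w ! i" if "i < 4 * n" for i
    using that uv(2,4) unfolding fam by (simp add: nth_append)
  have under: "?w ! i < 0" if "4 * n \<le> i" "i < 8 * n" for i
    using that uv(2,3,5) unfolding fam by (simp add: nth_append)
  have tail: "?w ! (8 * n + (4 * q + r)) = fst (bridge_block m q ! r)" if "q < m" "r < 4" for q r
  proof -
    have "?w ! (8 * n + (4 * q + r)) = fst (family_code m n ! (8 * n + (4 * q + r)))"
      by (rule nth_map) (use that in \<open>simp add: family_code_def\<close>)
    also have "family_code m n ! (8 * n + (4 * q + r)) = bridge_chain m m ! (4 * q + r)"
      unfolding family_code_def by (simp add: nth_append)
    finally show ?thesis using nth_chain[OF that] by simp
  qed
  have "bridges ?w \<subseteq> (\<lambda>q. 8 * n + (4 * q + 1)) ` {..<m}"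
  proof
    fix i assume "i \<in> bridges ?w"
    then have i: "i < 8 * n + 4 * m" "?w ! i < 0" "0 < ?w ! (Suc i mod (8 * n + 4 * m))"
      unfolding bridges_def len by auto
    have "8 * n \<le> i"
    proof (rule ccontr)
      assume less: "\<not> 8 * n \<le> i"
      then have "4 * n \<le> i" using over[of i] i(2) by linarith
      have S: "Suc i mod (8 * n + 4 * m) = Suc i" using less m by simp
      show False
      proof (cases "Suc i < 8 * n")
        case True
        then show False using under[of "Suc i"] \<open>4 * n \<le> i\<close> i(3) S by simp
      next
        case False
        then have "Suc i = 8 * n + (4 * 0 + 0)" using less by simp
        then have "?w ! Suc i = fst (bridge_block m 0 ! 0)" using tail[of 0 0] m by (metis less_le_trans zero_less_numeral zero_less_one)
        then show False using i(3) S by (simp add: bridge_block_def)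
      qed
    qed
    define q r where "q = (i - 8 * n) div 4" and "r = (i - 8 * n) mod 4"
    have ir: "i = 8 * n + (4 * q + r)" "r < 4" "q < m"
      using \<open>8 * n \<le> i\<close> i(1) unfolding q_def r_def by auto
    consider "r = 0" | "r = 1" | "r = 2" | "r = 3" using ir(2) by linarith
    then have "r = 1"
    proof cases
      case 1
      then have "Suc i mod (8 * n + 4 * m) = 8 * n + (4 * q + 1)" using ir by simp
      then have "0 < fst (bridge_block m q ! 1)" using i(3) tail[OF ir(3), of 1] by simp
      then show ?thesis by (simp add: bridge_block_def)
    next
      case 3
      then have "fst (bridge_block m q ! 2) < 0" using i(2) tail[OF ir(3), of 2] ir by simp
      then show ?thesis by (simp add: bridge_block_def)
    next
      case 4
      then have "fst (bridge_block m q ! 3) < 0" using i(2) tail[OF ir(3), of 3] ir by simp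
      then show ?thesis by (simp add: bridge_block_def)
    qed
    then show "i \<in> (\<lambda>q. 8 * n + (4 * q + 1)) ` {..<m}" using ir by auto
  qed
  then have "card (bridges ?w) \<le> card {..<m}" by (rule surj_card_le[rotated]) simp
  moreover have "family_code m n \<noteq> []" using len m by auto
  ultimately show ?thesis by (simp add: overbridges_eq)
qed

lemma colored_const: "(\<And>a. a \<in> set w \<Longrightarrow> z \<bar>a\<bar> = x) \<Longrightarrow> colored z x w x"
proof (induction w)
  case (Cons a w)
  have facts: "z \<bar>a\<bar> = x" "colored z x w x" using Cons by simp_all
  have "2 * x - x = x" by simp
  then show ?case by (simp only: colored.simps facts simp_thms if_cancel)
qed simp

text \<open>
  It suffices to extend every function on \<open>k\<close> parameters injectively to a colouring.
\<close>

lemma power_le_num_colorings: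
  fixes F :: "(nat \<Rightarrow> color) \<Rightarrow> color \<times> (int \<Rightarrow> color)"
  assumes inj: "\<And>f g i. f \<in> {..<k} \<rightarrow>\<^sub>E UNIV \<Longrightarrow> g \<in> {..<k} \<rightarrow>\<^sub>E UNIV \<Longrightarrow> F f = F g \<Longrightarrow> i < k \<Longrightarrow> f i = g i"
    and col: "\<And>f. F f \<in> colorings w"
  shows "3 ^ k \<le> num_colorings w"
proof -
  have "card ({..<k} \<rightarrow>\<^sub>E (UNIV :: color set)) = 3 ^ k" by (simp add: card_PiE)
  moreover have "card ({..<k} \<rightarrow>\<^sub>E (UNIV :: color set)) \<le> card (colorings w)"
  proof (rule card_inj_on_le[of F])
    show "inj_on F ({..<k} \<rightarrow>\<^sub>E UNIV)"
      by (rule inj_onI, rule PiE_ext) (use inj in auto)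
  qed (use col finite_colorings in auto)
  ultimately show ?thesis unfolding num_colorings_def by simp
qed

lemma colored_block:
  assumes "0 < p" "0 < q" "0 < r" "z p = y" "z q = x" "z r = y"
  shows "colored z x [- p, - q, p, r] y"
proof -
  have "2 * x - (2 * y - x) = y" unfolding double_color by simp
  then show ?thesis using assms by simp
qed

text \<open>
  A colouring assigns arbitrary colours to the \<open>m\<close> bridges; the gadgets get the colour of bridge \<open>0\<close>.
\<close>

lemma index_colorings_family_0:
  assumes m: "1 \<le> m"
  shows "3 ^ m \<le> index_colorings 0 (family_code m n)"
  unfolding index_colorings_0[OF gauss_code_family[OF m]]
proof (rule power_le_num_colorings)
  define Z :: "(nat \<Rightarrow> color) \<Rightarrow> int \<Rightarrow> color" where
    "Z f k = (if 1 \<le> k \<and> k \<le> int (2 * m) then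
        (if odd k then f (Suc (nat k div 2) mod m) else f (nat k div 2 - 1))
      else if int (2 * m) < k \<and> k \<le> int (2 * m + 4 * n) then f 0 else 0)" for f k
  have even: "Z f (int (2 * i + 2)) = f i" if "i < m" for f i
    using that unfolding Z_def by (simp add: nat_add_distrib nat_mult_distrib)
  have odd: "Z f (int (2 * i + 1)) = f (Suc i mod m)" if "i < m" for f i
    using that unfolding Z_def by (simp add: nat_add_distrib nat_mult_distrib)
  {
    fix f g :: "nat \<Rightarrow> color" and i
    assume "(f 0, Z f) = (g 0, Z g)" and i: "i < m"
    then have "Z f (int (2 * i + 2)) = Z g (int (2 * i + 2))" by simp
    then show "f i = g i" unfolding even[OF i] .
  }
  fix f
  have "colored (Z f) (f 0) (map fst (bridge_chain m q)) (f (q mod m))" if "q \<le> m" for q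
    using that
  proof (induction q)
    case 0
    then show ?case by (simp add: bridge_chain_def)
  next
    case (Suc q)
    have q: "q < m" "Suc q mod m < m" using Suc.prems m by auto
    have e1: "Z f (int (2 * q + 1)) = f (Suc q mod m)" "Z f (int (2 * q + 2)) = f q"
      "Z f (int (2 * (Suc q mod m) + 2)) = f (Suc q mod m)" using odd even q by auto
    have "colored (Z f) (f q) [- int (2 * q + 1), - int (2 * q + 2), int (2 * q + 1),
        int (2 * (Suc q mod m) + 2)] (f (Suc q mod m))"
      by (rule colored_block) (use e1 in simp_all)
    then have "colored (Z f) (f q) (map fst (bridge_block m q)) (f (Suc q mod m))"
      unfolding bridge_block_def list.map fst_conv .
    then show ?case using Suc q unfolding chain_Suc map_append colored_append by auto
  qed
  from this[of m] have "colored (Z f) (f 0) (map fst (bridge_chain m m)) (f 0)" by simp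
  moreover have "colored (Z f) (f 0) (map fst (gadgets (int (2 * m)) n)) (f 0)"
  proof (rule colored_const)
    fix a assume "a \<in> set (map fst (gadgets (int (2 * m)) n))"
    then have "int (2 * m) < \<bar>a\<bar> \<and> \<bar>a\<bar> \<le> int (2 * m) + 4 * int n"
      using fst_gadgets[of "int (2 * m)" n] by auto
    then show "Z f \<bar>a\<bar> = f 0" unfolding Z_def by auto
  qed
  ultimately have "colored (Z f) (f 0) (map fst (family_code m n)) (f 0)"
    unfolding family_code_def map_append colored_append by blast
  moreover have "Z f k = 0" if "k \<notin> abs ` set (map fst (family_code m n))" for k
  proof -
    have "k \<notin> abs ` {a. 1 \<le> \<bar>a\<bar> \<and> \<bar>a\<bar> \<le> int (2 * m + 4 * n)}"
      using that unfolding set_map fst_family[OF m] .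
    then have "\<not> (1 \<le> k \<and> k \<le> int (2 * m + 4 * n))" unfolding abs_labels by simp
    then show ?thesis unfolding Z_def by auto
  qed
  ultimately show "(f 0, Z f) \<in> colorings (map fst (family_code m n))"
    unfolding colorings_def by blast
qed

lemma total_gadgets: "total 1 (gadgets b n) = 0"
proof (induction n arbitrary: b)
  case (Suc n)
  have "sgn (- b) = - sgn b" for b :: int by (simp add: sgn_if)
  then show ?case using Suc[of "b + 4"] by (simp only: gadgets.simps total_simps)
qed simp

text \<open>
  The switched gadget reads \<open>-1, 2, 3, -4\<close> on the way in and \<open>-3, 4, 1, -2\<close> on the way out.
  Overstrand colours \<open>t, 2 t, 2 t, t\<close> are consistent in characteristic three and lead from the colour
  \<open>0\<close> to \<open>0\<close> on both ways.
\<close>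

lemma colored_gadgets:
  assumes "0 \<le> b" "potential 1 P s (gadgets b n)"
    and "\<And>j. j < n \<Longrightarrow> z (b + 4 * int j + 1) = t j \<and> z (b + 4 * int j + 2) = 2 * t j \<and>
      z (b + 4 * int j + 3) = 2 * t j \<and> z (b + 4 * int j + 4) = t j"
  shows "colored z 0 (map (switch_entry 1 P) (gadgets b n)) 0"
  using assms
proof (induction n arbitrary: b t s)
  case (Suc n)
  have b: "sgn (b + 1) = 1" "sgn (b + 2) = 1" "sgn (b + 3) = 1" "sgn (b + 4) = 1"
    "sgn (- (b + 1)) = -1" "sgn (- (b + 2)) = -1" "sgn (- (b + 3)) = -1" "sgn (- (b + 4)) = -1"
    using Suc.prems(1) by (auto simp: sgn_if)
  have P: "P (b + 1) = s" "P (b + 2) = s + 1" "P (b + 3) = s + 2" "P (b + 4) = s + 1"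
    "potential 1 P s (gadgets (b + 4) n)"
    "P (- (b + 3)) = s" "P (- (b + 4)) = s + 1" "P (- (b + 1)) = s + 2" "P (- (b + 2)) = s + 1"
    using Suc.prems(2) unfolding gadgets.simps potential_append total_simps potential.simps b total_gadgets
    by auto
  have pos: "0 < b + 1" "0 < b + 2" "0 < b + 3" "0 < b + 4" using Suc.prems(1) by auto
  have m: "switch_entry 1 P (b + 1, 1) = - (b + 1)" "switch_entry 1 P (b + 2, 1) = b + 2"
    "switch_entry 1 P (b + 3, - 1) = b + 3" "switch_entry 1 P (b + 4, - 1) = - (b + 4)"
    unfolding switch_entry_def using P pos by (simp_all del: minus_add_distrib)
  have IH: "colored z 0 (map (switch_entry 1 P) (gadgets (b + 4) n)) 0"
  proof (rule Suc.IH[OF _ P(5)])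
    show "0 \<le> b + 4" using Suc.prems(1) by simp
    fix j assume "j < n"
    have "b + 4 + 4 * int j = b + 4 * int (Suc j)" by simp
    then show "z (b + 4 + 4 * int j + 1) = t (Suc j) \<and> z (b + 4 + 4 * int j + 2) = 2 * t (Suc j) \<and>
        z (b + 4 + 4 * int j + 3) = 2 * t (Suc j) \<and> z (b + 4 + 4 * int j + 4) = t (Suc j)"
      using Suc.prems(3)[of "Suc j"] \<open>j < n\<close> by (simp only: Suc_less_eq)
  qed
  have z: "z (b + 1) = t 0" "z (b + 2) = 2 * t 0" "z (b + 3) = 2 * t 0" "z (b + 4) = t 0"
    using Suc.prems(3)[of 0] by auto
  have abs: "\<bar>b + 1\<bar> = b + 1" "\<bar>b + 2\<bar> = b + 2" "\<bar>b + 3\<bar> = b + 3" "\<bar>b + 4\<bar> = b + 4" using pos by auto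
  have "colored z 0 [- (b + 1), b + 2, b + 3, - (b + 4)] 0"
    using pos abs z by (simp del: minus_add_distrib)
  moreover have "colored z 0 [- (b + 3), b + 4, b + 1, - (b + 2)] 0"
    using pos abs z by (simp del: minus_add_distrib add: double_color)
  ultimately show ?case
    using IH unfolding gadgets.simps map_append list.map switch_entry_neg m minus_minus colored_append by blast
qed simp

text \<open>
  The parameters of the \<open>n\<close> gadgets are independent; all other crossings get the colour \<open>0\<close>.
\<close>

lemma index_colorings_family_1:
  assumes m: "1 \<le> m"
  shows "3 ^ n \<le> index_colorings 1 (family_code m n)"
proof -
  let ?b = "int (2 * m)"
  have g: "gauss_code (family_code m n)" using gauss_code_family[OF m] .
  obtain P where P: "potential 1 P 0 (family_code m n)" using gauss_potential[OF g] by blast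
  define Z :: "(nat \<Rightarrow> color) \<Rightarrow> int \<Rightarrow> color" where
    "Z t k = (if ?b < k \<and> k \<le> ?b + 4 * int n then
        (let j = nat (k - ?b - 1) div 4 in if nat (k - ?b - 1) mod 4 \<in> {1, 2} then 2 * t j else t j)
      else 0)" for t k
  have Z: "Z t (?b + 4 * int j + 1) = t j \<and> Z t (?b + 4 * int j + 2) = 2 * t j \<and>
      Z t (?b + 4 * int j + 3) = 2 * t j \<and> Z t (?b + 4 * int j + 4) = t j" if j: "j < n" for j t
  proof -
    have "Z t (?b + 4 * int j + 1 + int r) = (if r \<in> {1, 2} then 2 * t j else t j)" if "r < 4" for r
    proof -
      have "?b + 4 * int j + 1 + int r - ?b - 1 = int (4 * j + r)" by simp
      then have "nat (?b + 4 * int j + 1 + int r - ?b - 1) = 4 * j + r" by (simp only: nat_int)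
      then show ?thesis unfolding Z_def Let_def using j that by simp
    qed
    from this[of 0] this[of 1] this[of 2] this[of 3] show ?thesis by (simp add: add_ac)
  qed
  show ?thesis
    unfolding index_colorings_eq[OF g P]
  proof (rule power_le_num_colorings)
    fix f g :: "nat \<Rightarrow> color" and i
    assume "(0 :: color, Z f) = (0, Z g)" "i < n"
    then show "f i = g i" using Z[of i f] Z[of i g] by simp
  next
    fix t
    have "potential 1 P 0 (gadgets ?b n)" using P unfolding family_code_def potential_append by blast
    then have "colored (Z t) 0 (map (switch_entry 1 P) (gadgets ?b n)) 0"
      using Z by (intro colored_gadgets[where t = t]) auto
    moreover have "colored (Z t) 0 (map (switch_entry 1 P) (bridge_chain m m)) 0"
    proof (rule colored_const)
      fix a assume "a \<in> set (map (switch_entry 1 P) (bridge_chain m m))"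
      then have "\<bar>a\<bar> \<in> abs ` set (map (switch_entry 1 P) (bridge_chain m m))" by (rule imageI)
      then have "\<bar>a\<bar> \<in> abs ` fst ` set (bridge_chain m m)" unfolding abs_map_switch_entry .
      then have "\<bar>a\<bar> \<le> ?b" unfolding fst_chain[OF m] by auto
      then show "Z t \<bar>a\<bar> = 0" unfolding Z_def by simp
    qed
    ultimately have "colored (Z t) 0 (map (switch_entry 1 P) (family_code m n)) 0"
      unfolding family_code_def map_append colored_append by blast
    moreover have "Z t k = 0" if "k \<notin> abs ` set (map (switch_entry 1 P) (family_code m n))" for k
    proof -
      have "k \<notin> abs ` {a. 1 \<le> \<bar>a\<bar> \<and> \<bar>a\<bar> \<le> int (2 * m + 4 * n)}"
        using that unfolding abs_map_switch_entry fst_family[OF m] .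
      then have "\<not> (1 \<le> k \<and> k \<le> int (2 * m + 4 * n))" unfolding abs_labels by simp
      then show ?thesis unfolding Z_def by auto
    qed
    ultimately show "(0, Z t) \<in> colorings (map (switch_entry 1 P) (family_code m n))"
      unfolding colorings_def by blast
  qed
qed

definition family_knot :: "nat \<Rightarrow> nat \<Rightarrow> code set" where
  "family_knot m n = code_equiv `` {family_code m n}"

lemma family_knot_member:
  assumes "c \<in> family_knot m n"
  shows "gauss_code c" "\<omega> \<in> {0, 1} \<Longrightarrow> index_colorings \<omega> c = index_colorings \<omega> (family_code m n)"
  using assms index_colorings_equiv unfolding family_knot_def code_equiv_def by auto

lemma index_colorings_Nil: "index_colorings \<omega> [] \<le> 3"
  unfolding index_colorings_def switched_def using num_colorings_Nil by simp

lemma b1_family_knot: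
  assumes m: "1 \<le> m"
  shows "b1 (family_knot m n) = m"
proof -
  have mem: "family_code m n \<in> family_knot m n"
    unfolding family_knot_def code_equiv_def using gauss_code_family[OF m] by auto
  have ov: "m \<le> overbridges c" if "c \<in> family_knot m n" "c \<noteq> []" for c
  proof -
    have "(3::nat) ^ m \<le> 3 ^ overbridges c"
      using index_colorings_family_0[OF m, of n] family_knot_member(2)[OF that(1) insertI1]
        index_colorings_le_overbridges[OF family_knot_member(1)[OF that(1)] that(2)] by linarith
    then show ?thesis by simp
  qed
  have empty: "m = 1" if "[] \<in> family_knot m n"
  proof -
    have "(3::nat) ^ m \<le> 3 ^ 1"
      using index_colorings_family_0[OF m, of n] family_knot_member(2)[OF that insertI1] index_colorings_Nil[of 0] by simp
    then have "m \<le> 1" by (rule power_le_imp_le_exp[rotated]) simp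
    then show ?thesis using m by simp
  qed
  have nil: "[] \<in> unknot"
  proof -
    have "gauss_code []" unfolding gauss_code_def by (auto intro: exI[of _ 0])
    then show ?thesis unfolding unknot_def code_equiv_def by auto
  qed
  show ?thesis
  proof (cases "family_knot m n = unknot")
    case True
    then show ?thesis using empty nil unfolding b1_def by simp
  next
    case False
    have "[] \<notin> family_knot m n"
    proof
      assume "[] \<in> family_knot m n"
      then have "(family_code m n, []) \<in> code_equiv" unfolding family_knot_def by simp
      then have "code_equiv `` {family_code m n} = code_equiv `` {[]}"
        using equiv_class_eq[OF equiv_code_equiv] by blast
      then show False using False unfolding family_knot_def unknot_def by simp
    qed
    then have "m \<le> overbridges c" if "c \<in> family_knot m n" for c using ov that by metis
    then have "m \<le> Inf (overbridges ` family_knot m n)" using mem by (intro cInf_greatest) auto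
    moreover have "Inf (overbridges ` family_knot m n) \<le> overbridges (family_code m n)"
      using mem by (intro cInf_lower) auto
    ultimately show ?thesis using overbridges_family[OF m, of n] False unfolding b1_def by simp
  qed
qed

text \<open>
  The condition on \<open>n\<close> excludes the empty code, which has three colourings.
\<close>

lemma b2_family_knot:
  assumes m: "1 \<le> m" and n: "2 \<le> n"
  shows "enat n \<le> b2 (family_knot m n)"
  unfolding b2_def
proof (rule Inf_greatest, clarify)
  fix \<gamma> X assume d: "diagram_of \<gamma> X (family_knot m n)" and h: "height_generic \<gamma>"
  then obtain c where c: "virtual_diagram \<gamma> X" "c \<in> family_knot m n" "diagram_code \<gamma> X c"
    unfolding diagram_of_def by blast
  have le: "3 ^ n \<le> index_colorings 1 c" using index_colorings_family_1[OF m, of n] family_knot_member(2)[OF c(2), of 1] by simp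
  have "c \<noteq> []"
  proof
    assume "c = []"
    then have "(3::nat) ^ n \<le> 3 ^ 1" using le index_colorings_Nil[of 1] by simp
    then have "n \<le> 1" by (rule power_le_imp_le_exp[rotated]) simp
    then show False using n by simp
  qed
  then have "(3::nat) ^ n \<le> 3 ^ card (local_maxima \<gamma>)"
    using le index_colorings_le_local_maxima[OF c(1) h c(3) family_knot_member(1)[OF c(2)], of 1] by linarith
  then show "enat n \<le> enat (card (local_maxima \<gamma>))" by simp
qed

theorem theorem3p1:
  shows "\<exists>K :: nat \<Rightarrow> nat \<Rightarrow> code set.
           (\<forall>m\<ge>1. \<forall>n\<ge>1. K m n \<in> virtual_knots \<and> b1 (K m n) = m) \<and>
           (\<forall>m\<ge>1. (\<lambda>n. ereal_of_enat (b2 (K m n)) - ereal (real (b1 (K m n)))) \<longlonglongrightarrow> \<infinity>)"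
proof (intro exI conjI allI impI)
  fix m n :: nat assume m: "1 \<le> m"
  show "family_knot m n \<in> virtual_knots"
    unfolding family_knot_def virtual_knots_def using gauss_code_family[OF m] by (auto intro: quotientI)
  show "b1 (family_knot m n) = m" using b1_family_knot[OF m] .
next
  fix m :: nat assume m: "1 \<le> m"
  show "(\<lambda>n. ereal_of_enat (b2 (family_knot m n)) - ereal (real (b1 (family_knot m n)))) \<longlonglongrightarrow> \<infinity>"
    unfolding tendsto_PInfty
  proof
    fix r :: real
    have "\<forall>\<^sub>F n :: nat in sequentially. 2 \<le> n \<and> r + real m < real n"
      by (intro eventually_conj eventually_ge_at_top)
        (metis eventually_at_top_dense filterlim_real_sequentially filterlim_at_top_dense)
    then show "\<forall>\<^sub>F n in sequentially. ereal r < ereal_of_enat (b2 (family_knot m n)) - ereal (real (b1 (family_knot m n)))"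
    proof (rule eventually_mono)
      fix n :: nat assume n: "2 \<le> n \<and> r + real m < real n"
      have "ereal r < ereal (real n) - ereal (real m)" using n by simp
      also have "ereal (real n) \<le> ereal_of_enat (b2 (family_knot m n))"
        using b2_family_knot[OF m, of n] n ereal_of_enat_le_iff[of "enat n" "b2 (family_knot m n)"] by simp
      then have "ereal (real n) - ereal (real m) \<le> ereal_of_enat (b2 (family_knot m n)) - ereal (real m)"
        by (rule ereal_minus_mono) simp
      finally show "ereal r < ereal_of_enat (b2 (family_knot m n)) - ereal (real (b1 (family_knot m n)))"
        unfolding b1_family_knot[OF m] .
    qed
  qed
qed
end
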